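(* Let $\mu\subseteq\lambda\subseteq(m^n)$ be partitions (regarded as having $n$ parts by appending zeros), let $\mu^\vee=(m-\mu_n,m-\mu_{n-1},\ldots,m-\mu_1)$, and let $A$ be an $n\times m$ matrix with entries in $\mathbb N$. Suppose that $\operatorname{RSK}(A)=(P,Q)$, where $P$ has entries in $\{1,\ldots,m\}$ and $Q$ has entries in $\{1,\ldots,n\}$. Then $\operatorname{supp}(A)\subseteq\lambda/\mu$ if and only if $(P,Q)$ is $\lambda$-admissible and $\bigl(\operatorname{ev}_m(P),\operatorname{ev}_n(Q)\bigr)$ is $\mu^\vee$-admissible.
   Context: $\mathbb N=\{0,1,2,\ldots\}$. $\operatorname{Tab}_{[r]}$ is the set of semistandard Young tableaux (English notation) with entries in $[r]=\{1,\ldots,r\}$. For fillings of the same shape, $\le$ means entrywise comparison. $\operatorname{ev}_r:\operatorname{Tab}_{[r]}\to\operatorname{Tab}_{[r]}$ is the Schützenberger involution (evacuation), which preserves shape and reverses weight. $\operatorname{supp}(A)=\{(i,j):A_{ij}\ne0\}$; $\lambda/\mu=\{(i,j):1\le i\le n,\ \mu_i<j\le\lambda_i\}$. RSK: to $A$ associate the biword containing $\binom ij$ exactly $A_{ij}$ times, sorted lexicographically ($i_1\le i_2\le\cdots$, and $j_k\le j_{k+1}$ whenever $i_k=i_{k+1}$). Then $P$ is obtained by successively row-inserting the $j_k$ and $Q$ is the recording tableau with $i_k$ in the cell added at step $k$. For $\alpha\in\mathbb N^n$, $\alpha^+$ is its weakly decreasing rearrangement and $K(\alpha)$ is the key tableau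 of shape $\alpha^+$ and content $\alpha$ (column $r$ is $\{i:\alpha_i\ge r\}$). $K_+(T)$ is the (Lascoux–Schützenberger) right key of $T$. Equivalently: let $T_r$ be the subtableau of columns of $T$ weakly to the right of column $r$, with reading word obtained by reading rows left to right from bottom row to top row; then column $r$ of $K_+(T)$, read bottom to top, is $\sup W(T_r)$, where $W(T_r)$ is the set of strictly decreasing subwords of the reading word and $\sup$ of a set of decreasing words of maximal length $t$ is $w_1\cdots w_t$ with $w_i$ the maximum of the $i$-th letters of its words of length $\ge i$. For a partition $\kappa\subseteq(m^n)$ with $n$ parts (zeros allowed), and $\alpha\in\mathbb N^n$, $B_+^\kappa(\alpha)$ is the filling of shape $\alpha^+$ such that, if column $r$ has length $c_r$, its $i$-th entry from the top is $\kappa_p$, where $p$ is the $(c_r+1-i)$-th entry from the top of column $r$ of $K(\alpha)$. A pair $(P,Q)\in\operatorname{Tab}_{[m]}\times\operatorname{Tab}_{[n]}$ of the same shape is $\kappa$-admissible if, for the $\alpha$ with $K_+(Q)=K(\alpha)$, one has $K_+(P)\le B_+^\kappa(\alpha)$. *)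

theory Defs
  imports Main "HOL-Library.Sublist"
begin

text \<open>
  Partitions with \<open>n\<close> parts and weak compositions in \<open>\<nat>\<^sup>n\<close> are lists of length \<open>n\<close>; their
  \<open>i\<close>-th part, \<open>1 \<le> i \<le> n\<close>, is \<open>! (i - 1)\<close>. An \<open>n \<times> m\<close> matrix is a function of which only
  the values on \<open>{1..n} \<times> {1..m}\<close> matter. Fillings are lists of their nonempty rows, from top
  to bottom (English notation); \<^const>\<open>transpose\<close> translates between the list of rows and the
  list of columns (each column read from top to bottom).
\<close>

subsection \<open>Partitions and supports\<close>

definition partition_in_box :: "nat \<Rightarrow> nat \<Rightarrow> nat list \<Rightarrow> bool" where
  "partition_in_box n m p \<longleftrightarrow> length p = n \<and> sorted_wrt (\<ge>) p \<and> (\<forall>x\<in>set p. x \<le> m)"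

definition partition_subset :: "nat list \<Rightarrow> nat list \<Rightarrow> bool" where
  "partition_subset mu lam \<longleftrightarrow> list_all2 (\<le>) mu lam"

definition box_complement :: "nat \<Rightarrow> nat list \<Rightarrow> nat list" where
  "box_complement m mu = map (\<lambda>x. m - x) (rev mu)"

definition skew_diagram :: "nat \<Rightarrow> nat list \<Rightarrow> nat list \<Rightarrow> (nat \<times> nat) set" where
  "skew_diagram n lam mu = {(i, j). 1 \<le> i \<and> i \<le> n \<and> mu ! (i - 1) < j \<and> j \<le> lam ! (i - 1)}"

definition supp :: "nat \<Rightarrow> nat \<Rightarrow> (nat \<Rightarrow> nat \<Rightarrow> nat) \<Rightarrow> (nat \<times> nat) set" where
  "supp n m A = {(i, j). i \<in> {1..n} \<and> j \<in> {1..m} \<and> A i j \<noteq> 0}"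

subsection \<open>Tableaux\<close>

definition shape :: "nat list list \<Rightarrow> nat list" where
  "shape T = map length T"

definition Tab :: "nat \<Rightarrow> nat list list set" where
  "Tab r = {T. (\<forall>row\<in>set T. row \<noteq> [] \<and> sorted row \<and> set row \<subseteq> {1..r}) \<and>
               sorted_wrt (\<lambda>x y. length y \<le> length x \<and> (\<forall>j<length y. x ! j < y ! j)) T}"

definition num_cols :: "nat list list \<Rightarrow> nat" where
  "num_cols T = (case T of [] \<Rightarrow> 0 | row # _ \<Rightarrow> length row)"

text \<open>Entrywise comparison; the use of \<^const>\<open>list_all2\<close> includes equality of shapes.\<close>

definition filling_le :: "nat list list \<Rightarrow> nat list list \<Rightarrow> bool" where
  "filling_le S T \<longleftrightarrow> list_all2 (list_all2 (\<le>)) S T"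

definition reading_word :: "nat list list \<Rightarrow> nat list" where
  "reading_word T = concat (rev T)"

subsection \<open>The RSK correspondence\<close>

text \<open>
  \<open>row_bump x row\<close> inserts \<open>x\<close> into a single row: the leftmost entry greater than \<open>x\<close> is
  replaced by \<open>x\<close> and returned; if there is none, \<open>x\<close> is appended.
\<close>

fun row_bump :: "nat \<Rightarrow> nat list \<Rightarrow> nat list \<times> nat option" where
  "row_bump x [] = ([x], None)"
| "row_bump x (y # ys) =
     (if x < y then (x # ys, Some y)
      else (case row_bump x ys of (zs, b) \<Rightarrow> (y # zs, b)))"

fun row_insert :: "nat \<Rightarrow> nat list list \<Rightarrow> nat list list" where
  "row_insert x [] = [[x]]"
| "row_insert x (row # rows) =
     (case row_bump x row of
        (row', None) \<Rightarrow> row' # rows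
      | (row', Some y) \<Rightarrow> row' # row_insert y rows)"

text \<open>The index (starting with 0) of the row in which \<^const>\<open>row_insert\<close> adds a cell.\<close>

fun new_cell_row :: "nat \<Rightarrow> nat list list \<Rightarrow> nat" where
  "new_cell_row x [] = 0"
| "new_cell_row x (row # rows) =
     (case snd (row_bump x row) of None \<Rightarrow> 0 | Some y \<Rightarrow> Suc (new_cell_row y rows))"

definition add_to_row :: "nat \<Rightarrow> nat \<Rightarrow> nat list list \<Rightarrow> nat list list" where
  "add_to_row k i Q = (if k < length Q then Q[k := Q ! k @ [i]] else Q @ [[i]])"

definition rsk_step ::
  "nat \<times> nat \<Rightarrow> nat list list \<times> nat list list \<Rightarrow> nat list list \<times> nat list list" where
  "rsk_step = (\<lambda>(i, j) (P, Q). (row_insert j P, add_to_row (new_cell_row j P) i Q))"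

definition biword :: "nat \<Rightarrow> nat \<Rightarrow> (nat \<Rightarrow> nat \<Rightarrow> nat) \<Rightarrow> (nat \<times> nat) list" where
  "biword n m A =
     concat (map (\<lambda>i. concat (map (\<lambda>j. replicate (A i j) (i, j)) [1..<Suc m])) [1..<Suc n])"

definition RSK ::
  "nat \<Rightarrow> nat \<Rightarrow> (nat \<Rightarrow> nat \<Rightarrow> nat) \<Rightarrow> nat list list \<times> nat list list" where
  "RSK n m A = fold rsk_step (biword n m A) ([], [])"

subsection \<open>The Schuetzenberger involution\<close>

definition insertion_tableau :: "nat list \<Rightarrow> nat list list" where
  "insertion_tableau w = fold row_insert w []"

text \<open>
  On words over \<open>{1..r}\<close> the involution reverses the word and replaces each letter \<open>x\<close> by
  \<open>r + 1 - x\<close>; on tableaux it is the induced map on plactic classes (Lascoux, Leclerc and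
  Thibon, ``The plactic monoid'', in Lothaire, Algebraic Combinatorics on Words).
\<close>

definition ev :: "nat \<Rightarrow> nat list list \<Rightarrow> nat list list" where
  "ev r T = insertion_tableau (rev (map (\<lambda>x. r + 1 - x) (reading_word T)))"

subsection \<open>Keys\<close>

definition key_columns :: "nat list \<Rightarrow> nat list list" where
  "key_columns a =
     map (\<lambda>r. filter (\<lambda>i. r \<le> a ! (i - 1)) [1..<Suc (length a)])
         [1..<Suc (Max (insert 0 (set a)))]"

definition key :: "nat list \<Rightarrow> nat list list" where
  "key a = transpose (key_columns a)"

definition decreasing_subwords :: "nat list \<Rightarrow> nat list set" where
  "decreasing_subwords u = {w. subseq w u \<and> sorted_wrt (>) w}"

definition word_sup :: "nat list set \<Rightarrow> nat list" where
  "word_sup W = map (\<lambda>i. Max {w ! i | w. w \<in> W \<and> i < length w}) [0..<Max (length ` W)]"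

text \<open>Columns are numbered from 0 here, so \<open>columns_from 0 T = T\<close>.\<close>

definition columns_from :: "nat \<Rightarrow> nat list list \<Rightarrow> nat list list" where
  "columns_from r T = filter (\<lambda>row. row \<noteq> []) (map (drop r) T)"

definition right_key :: "nat list list \<Rightarrow> nat list list" where
  "right_key T =
     transpose (map (\<lambda>r. rev (word_sup (decreasing_subwords (reading_word (columns_from r T)))))
                    [0..<num_cols T])"

subsection \<open>Admissible pairs\<close>

text \<open>
  In a column of length \<open>c\<close>, the \<open>i\<close>-th entry is determined by the \<open>(c + 1 - i)\<close>-th entry of
  the corresponding column of the key; hence the reversal.
\<close>

definition B_plus :: "nat list \<Rightarrow> nat list \<Rightarrow> nat list list" where
  "B_plus kappa a = transpose (map (\<lambda>col. rev (map (\<lambda>p. kappa ! (p - 1)) col)) (key_columns a))"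

definition admissible ::
  "nat \<Rightarrow> nat \<Rightarrow> nat list \<Rightarrow> nat list list \<times> nat list list \<Rightarrow> bool" where
  "admissible n m kappa = (\<lambda>(P, Q).
     P \<in> Tab m \<and> Q \<in> Tab n \<and> shape P = shape Q \<and>
     (\<exists>a. length a = n \<and> right_key Q = key a \<and> filling_le (right_key P) (B_plus kappa a)))"

end

theory Submission
  imports Defs "HOL-Library.Product_Lexorder" "HOL-Library.Multiset"
begin

text \<open>
  Write \<open>T\<^sub>r\<close> for the columns \<open>\<ge> r\<close> of a tableau \<open>T\<close>, let \<open>f b r T\<close> be the maximal length of a
  strictly decreasing subword of \<open>T\<^sub>r\<close> with letters \<open>\<ge> b\<close>, and let \<open>h r T\<close> be the height of column
  \<open>r\<close>. Column \<open>r\<close> of the right key has \<open>f b r T\<close> letters \<open>\<ge> b\<close>, so that \<open>(P, Q)\<close> is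
  \<open>\<kappa>\<close>-admissible iff \<open>f (\<kappa>\<^sub>a + 1) r P + f a r Q \<le> h r P\<close> for all \<open>a\<close> and \<open>r\<close>. For fixed \<open>a\<close> and
  \<open>b\<close>, the inequalities \<open>f b r P + f a r Q \<le> h r P\<close> hold for all \<open>r\<close> iff the block of \<open>A\<close> in rows
  \<open>\<ge> a\<close> and columns \<open>\<ge> b\<close> vanishes. This is shown along the biword. Let a biletter \<open>(i, j)\<close> with
  \<open>i \<ge> a\<close> create a cell in column \<open>s\<close>. If \<open>j \<ge> b\<close>, the bumping path shows \<open>f b s P = h s P\<close>, while
  \<open>f a s Q > 0\<close>: the inequality fails. If \<open>j < b\<close>, then up to column \<open>s\<close> the insertion is an
  insertion into \<open>P\<^sub>r\<close>, so \<open>f b r P\<close> is unchanged by Knuth invariance, and the changes of \<open>f b\<close>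
  right of \<open>s\<close> and of \<open>f a r Q\<close> are controlled well enough to preserve the inequalities in both
  directions. The condition on \<open>\<mu>\<close> follows by rotating \<open>A\<close> by 180 degrees, which applies evacuation
  to \<open>P\<close> (Knuth equivalence) and to \<open>Q\<close> (symmetry of RSK).
\<close>

subsection \<open>Row insertion\<close>

lemma row_bump_None:
  "(\<forall>y\<in>set R. y \<le> x) \<Longrightarrow> row_bump x R = (R @ [x], None)"
  by (induction R) auto

lemma row_bump_append:
  "(\<forall>y\<in>set R. y \<le> x) \<Longrightarrow> row_bump x (R @ S) = (case row_bump x S of (S', b) \<Rightarrow> (R @ S', b))"
  by (induction R) (auto split: prod.splits)

lemma row_bump_Some:
  "(\<forall>y\<in>set R. y \<le> x) \<Longrightarrow> x < z \<Longrightarrow> row_bump x (R @ z # S) = (R @ x # S, Some z)"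
  by (simp add: row_bump_append)

lemma row_bump_cases:
  obtains (None) "\<forall>y\<in>set R. y \<le> x" "row_bump x R = (R @ [x], None)"
  | (Some) B z C where "R = B @ z # C" "\<forall>y\<in>set B. y \<le> x" "x < z"
      "row_bump x R = (B @ x # C, Some z)"
proof (cases "\<forall>y\<in>set R. y \<le> x")
  case True
  then show ?thesis using row_bump_None that(1) by blast
next
  case False
  then have "\<exists>y\<in>set R. x < y" by (auto simp: not_le)
  from split_list_first_prop[OF this] obtain B z C
    where "R = B @ z # C" "x < z" "\<forall>y\<in>set B. \<not> x < y" by blast
  then show ?thesis using row_bump_Some that(2) by (metis linorder_not_less)
qed

section \<open>Tableau conditions and the bumping path\<close>

definition row_above :: "nat list \<Rightarrow> nat list \<Rightarrow> bool" where
  "row_above x y \<longleftrightarrow> length y \<le> length x \<and> (\<forall>j<length y. x ! j < y ! j)"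

text \<open>The conditions of \<open>Tab\<close> without a bound on the entries, since insertion
  preserves them over any alphabet.\<close>

definition tableau :: "nat list list \<Rightarrow> bool" where
  "tableau T \<longleftrightarrow> (\<forall>R\<in>set T. R \<noteq> [] \<and> sorted R) \<and> sorted_wrt row_above T"

lemma Tab_iff: "T \<in> Tab r \<longleftrightarrow> tableau T \<and> (\<forall>R\<in>set T. set R \<subseteq> {1..r})"
  unfolding Tab_def tableau_def row_above_def[abs_def] by auto

lemma row_above_trans: "row_above x y \<Longrightarrow> row_above y z \<Longrightarrow> row_above x z"
  unfolding row_above_def by (meson dual_order.trans less_le_trans order.strict_trans)

lemma tableau_Nil [simp]: "tableau []"
  by (simp add: tableau_def)

lemma tableau_Cons:
  "tableau (R # T) \<longleftrightarrow> R \<noteq> [] \<and> sorted R \<and> tableau T \<and> (T \<noteq> [] \<longrightarrow> row_above R (hd T))"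
proof (cases T)
  case (Cons S T')
  then show ?thesis
    unfolding tableau_def by (auto dest: row_above_trans)
qed (simp add: tableau_def)

lemma row_insert_bump_Some:
  "row_bump x R = (R', Some z) \<Longrightarrow> row_insert x (R # T) = R' # row_insert z T"
  by simp

definition bump_pos :: "nat \<Rightarrow> nat list \<Rightarrow> nat" where
  "bump_pos x R = length (takeWhile (\<lambda>y. y \<le> x) R)"

lemma bump_pos_None: "\<forall>y\<in>set R. y \<le> x \<Longrightarrow> bump_pos x R = length R"
  unfolding bump_pos_def by (metis takeWhile_eq_all_conv)

lemma bump_pos_Some: "\<forall>y\<in>set B. y \<le> x \<Longrightarrow> x < z \<Longrightarrow> bump_pos x (B @ z # C) = length B"
  unfolding bump_pos_def by (subst takeWhile_append2) auto

text \<open>The bumped letter \<open>z\<close> leaves column \<open>length B\<close>. An entry of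
  \<open>S\<close> in that column is larger than \<open>z\<close>, so bumping paths move weakly to
  the left.\<close>

lemma bump_pos_left:
  assumes "row_above (B @ z # C) S"
  shows "bump_pos z S \<le> length B"
proof (rule ccontr)
  assume "\<not> ?thesis"
  then have l: "length B < length (takeWhile (\<lambda>y. y \<le> z) S)" by (simp add: bump_pos_def)
  then have "S ! length B \<le> z"
    by (metis nth_mem set_takeWhileD takeWhile_nth)
  moreover have "length B < length S"
    using l length_takeWhile_le less_le_trans by blast
  ultimately show False using assms unfolding row_above_def
    by (metis leD nth_append_length)
qed

lemma bump_pos_le: "bump_pos x R \<le> length R"
  by (simp add: bump_pos_def length_takeWhile_le)

lemma row_bump_pos:
  "row_bump x R = (if bump_pos x R = length R then (R @ [x], None)
     else (R[bump_pos x R := x], Some (R ! bump_pos x R)))"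
proof (cases rule: row_bump_cases[of R x])
  case None
  then show ?thesis using bump_pos_None by auto
next
  case (Some B z C)
  then show ?thesis using bump_pos_Some[of B x z C] by auto
qed

lemma sorted_row_bump:
  assumes "sorted R" shows "sorted (fst (row_bump x R))"
proof (cases rule: row_bump_cases[of R x])
  case None
  then show ?thesis using assms by (auto simp: sorted_append)
next
  case (Some B z C)
  then show ?thesis using assms by (force simp: sorted_append)
qed

text \<open>Entries of the upper row only decrease, and the lower row changes only in column
  \<open>?q\<close>, which receives \<open>z\<close>. By \<open>bump_pos_left\<close> the letter
  above it is \<open>x\<close> or belongs to \<open>B\<close>, hence is less than
  \<open>z\<close>.\<close>

lemma row_above_bump:
  assumes "R = B @ z # C" "\<forall>y\<in>set B. y \<le> x" "x < z" "row_above R S"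
  shows "row_above (B @ x # C) (fst (row_bump z S))"
proof -
  let ?q = "bump_pos z S"
  have q: "?q \<le> length B" "?q \<le> length S" using bump_pos_left bump_pos_le assms by auto
  define R' where "R' = B @ x # C"
  have le: "R' ! j \<le> R ! j" for j
    using assms by (cases "j = length B") (auto simp: nth_append nth_Cons' R'_def)
  have len: "length R' = length R" "length B < length R" using assms(1) by (auto simp: R'_def)
  have atq: "R' ! ?q < z"
    using q(1) assms(2,3)
    by (cases "?q = length B") (auto simp: R'_def nth_append le_less dest!: bspec[of _ _ "B ! ?q"])
  have lt: "R' ! j < S ! j" if "j < length S" for j
    using that le[of j] assms(4) unfolding row_above_def by (meson le_less_trans)
  have "row_above R' (fst (row_bump z S))"
  proof (cases "?q = length S")
    case True
    then show ?thesis using assms(4) q len atq lt unfolding row_above_def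
      by (auto simp: row_bump_pos nth_append less_Suc_eq)
  next
    case False
    then show ?thesis using assms(4) q len atq lt unfolding row_above_def
      by (auto simp: row_bump_pos nth_list_update)
  qed
  then show ?thesis by (simp add: R'_def)
qed

lemma hd_row_insert: "T \<noteq> [] \<Longrightarrow> hd (row_insert x T) = fst (row_bump x (hd T))"
  by (cases T) (auto split: prod.splits option.splits)

lemma tableau_row_insert: "tableau T \<Longrightarrow> tableau (row_insert x T)"
proof (induction T arbitrary: x)
  case Nil
  then show ?case by (simp add: tableau_Cons)
next
  case (Cons R T)
  then have T: "R \<noteq> []" "sorted R" "tableau T" "T \<noteq> [] \<Longrightarrow> row_above R (hd T)"
    by (auto simp: tableau_Cons)
  show ?case
  proof (cases rule: row_bump_cases[of R x])
    case None
    have "row_above R S \<Longrightarrow> row_above (R @ [x]) S" for S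
      unfolding row_above_def by (auto simp: nth_append)
    then show ?thesis using T None sorted_row_bump[of R x] by (auto simp: tableau_Cons)
  next
    case (Some B z C)
    have "row_above (B @ x # C) (hd (row_insert z T))"
    proof (cases "T = []")
      case True
      then show ?thesis using Some(2,3)
        by (cases B) (auto simp: row_above_def)
    next
      case False
      then show ?thesis using row_above_bump[OF Some(1-3)] T(4) hd_row_insert by auto
    qed
    then show ?thesis using Some sorted_row_bump[of R x] T Cons.IH by (auto simp: tableau_Cons)
  qed
qed

lemma set_row_insert: "\<Union> (set ` set (row_insert x T)) \<subseteq> insert x (\<Union> (set ` set T))"
proof (induction T arbitrary: x)
  case (Cons R T)
  show ?case
  proof (cases rule: row_bump_cases[of R x])
    case (Some B z C)
    then show ?thesis using Cons.IH[of z] by auto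
  qed auto
qed simp

text \<open>The length of the receiving row before insertion is the column of the new cell, counted
  from 0. The default 0 is the correct value for a new bottom row.\<close>

definition new_cell_col :: "nat \<Rightarrow> nat list list \<Rightarrow> nat" where
  "new_cell_col x T = (if new_cell_row x T < length T then length (T ! new_cell_row x T) else 0)"

lemma new_cell_row_le: "new_cell_row x T \<le> length T"
  by (induction x T rule: new_cell_row.induct) (auto split: option.splits)

lemma new_cell_col_Nil [simp]: "new_cell_col x [] = 0"
  by (simp add: new_cell_col_def)

lemma new_cell_col_None: "row_bump x R = (R', None) \<Longrightarrow> new_cell_col x (R # T) = length R"
  by (simp add: new_cell_col_def)

lemma new_cell_col_Some: "row_bump x R = (R', Some z) \<Longrightarrow> new_cell_col x (R # T) = new_cell_col z T"
  by (simp add: new_cell_col_def)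

text \<open>The path enters in column \<open>bump_pos x R\<close> and moves weakly left until it
  ends in the new cell.\<close>

lemma new_cell_col_le_bump_pos: "tableau (R # T) \<Longrightarrow> new_cell_col x (R # T) \<le> bump_pos x R"
proof (induction T arbitrary: x R)
  case Nil
  show ?case
  proof (cases rule: row_bump_cases[of R x])
    case None
    then show ?thesis by (simp add: new_cell_col_None bump_pos_None)
  next
    case (Some B z C)
    then show ?thesis by (simp add: new_cell_col_Some)
  qed
next
  case (Cons S T)
  then have T: "tableau (S # T)" "row_above R S" by (auto simp: tableau_Cons)
  show ?case
  proof (cases rule: row_bump_cases[of R x])
    case None
    then show ?thesis by (simp add: new_cell_col_None bump_pos_None)
  next
    case (Some B z C)
    then have "new_cell_col x (R # S # T) = new_cell_col z (S # T)" by (simp add: new_cell_col_Some)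
    also have "\<dots> \<le> bump_pos z S" using Cons.IH T(1) .
    also have "\<dots> \<le> length B" using bump_pos_left T(2) Some(1) by simp
    finally show ?thesis using Some bump_pos_Some by simp
  qed
qed

text \<open>The label \<open>i\<close> is arbitrary, as only lengths matter. This keeps the two
  tableaux of RSK of the same shape.\<close>

lemma shape_row_insert:
  "map length (row_insert x T) = map length (add_to_row (new_cell_row x T) i T)"
proof (induction T arbitrary: x)
  case Nil
  then show ?case by (simp add: add_to_row_def)
next
  case (Cons R T)
  show ?case
  proof (cases rule: row_bump_cases[of R x])
    case None
    then show ?thesis by (simp add: add_to_row_def)
  next
    case (Some B z C)
    then show ?thesis using Cons[of z] by (simp add: add_to_row_def split: if_splits)
  qed
qed

subsection \<open>Knuth equivalence\<close>

inductive knuth :: "nat list \<Rightarrow> nat list \<Rightarrow> bool" where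
  knuth_refl [simp, intro]: "knuth u u"
| knuth_sym: "knuth u v \<Longrightarrow> knuth v u"
| knuth_trans [trans]: "knuth u v \<Longrightarrow> knuth v w \<Longrightarrow> knuth u w"
| knuth_yzx: "x < y \<Longrightarrow> y \<le> z \<Longrightarrow> knuth (u @ [y, x, z] @ v) (u @ [y, z, x] @ v)"
| knuth_xzy: "x \<le> y \<Longrightarrow> y < z \<Longrightarrow> knuth (u @ [x, z, y] @ v) (u @ [z, x, y] @ v)"

lemma knuth_append:
  "knuth u v \<Longrightarrow> knuth (p @ u @ q) (p @ v @ q)"
proof (induction rule: knuth.induct)
  case (knuth_yzx x y z u v)
  then show ?case using knuth.knuth_yzx[of x y z "p @ u" "v @ q"] by simp
next
  case (knuth_xzy x y z u v)
  then show ?case using knuth.knuth_xzy[of x y z "p @ u" "v @ q"] by simp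
qed (blast intro: knuth.intros)+

lemma knuth_append_left: "knuth u v \<Longrightarrow> knuth (p @ u) (p @ v)"
  using knuth_append[of u v p "[]"] by simp

lemma knuth_append_right: "knuth u v \<Longrightarrow> knuth (u @ q) (v @ q)"
  using knuth_append[of u v "[]" q] by simp

text \<open>The letter \<open>x\<close> travels left through \<open>C\<close>. It passes each letter
  \<open>c\<close> by the relation \<open>knuth_yzx\<close>, with the letter preceding
  \<open>c\<close> as \<open>y\<close>.\<close>

lemma knuth_row_small:
  "sorted (z # C) \<Longrightarrow> x < z \<Longrightarrow> knuth (z # C @ [x]) (z # x # C)"
proof (induction C rule: rev_induct)
  case (snoc c C)
  have last: "last (z # C) \<le> c" "x < last (z # C)" using snoc.prems
    by (auto simp: sorted_append intro: less_le_trans)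
  obtain u where u: "z # C = u @ [last (z # C)]" by (metis append_butlast_last_id list.distinct(1))
  have "knuth (u @ [last (z # C), x, c] @ []) (u @ [last (z # C), c, x] @ [])"
    using knuth_yzx last by blast
  then have "knuth (z # C @ [c, x]) (z # C @ [x, c])"
    using u knuth_sym by (metis append.assoc append_Cons append_Nil append_Nil2)
  moreover have "knuth (z # C @ [x, c]) (z # x # C @ [c])"
    using knuth_append_right[OF snoc.IH, of "[c]"] snoc.prems by (auto simp: sorted_append)
  ultimately show ?case using knuth_trans by simp
qed simp

text \<open>The letter \<open>z\<close> travels left through \<open>B\<close>. It passes each letter
  \<open>b\<close> by the relation \<open>knuth_xzy\<close>, with the letter to the right of
  \<open>z\<close> as \<open>y\<close>.\<close>

lemma knuth_row_big:
  "sorted (B @ [x]) \<Longrightarrow> x < z \<Longrightarrow> knuth (B @ z # x # C) (z # B @ x # C)"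
proof (induction B arbitrary: x C rule: rev_induct)
  case (snoc b B)
  have "knuth (B @ [b, z, x] @ C) (B @ [z, b, x] @ C)"
    using snoc.prems by (intro knuth_xzy) (auto simp: sorted_append)
  moreover have "knuth (B @ z # b # (x # C)) (z # B @ b # (x # C))"
    using snoc.prems by (intro snoc.IH) (auto simp: sorted_append)
  ultimately show ?case using knuth_trans by simp
qed simp

lemma knuth_row_bump:
  assumes "sorted R" "row_bump x R = (R', Some z)"
  shows "knuth (R @ [x]) (z # R')"
proof -
  from assms(2) obtain B C where B: "R = B @ z # C" "\<forall>y\<in>set B. y \<le> x" "x < z" "R' = B @ x # C"
    by (cases rule: row_bump_cases[of R x]) auto
  have "knuth (B @ (z # C @ [x])) (B @ (z # x # C))"
    using assms(1) B by (intro knuth_append_left knuth_row_small) (auto simp: sorted_append)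
  moreover have "knuth (B @ z # x # C) (z # B @ x # C)"
    using assms(1) B by (intro knuth_row_big) (auto simp: sorted_append)
  ultimately show ?thesis using B knuth_trans by simp
qed

lemma reading_word_Nil [simp]: "reading_word [] = []"
  by (simp add: reading_word_def)

lemma reading_word_Cons [simp]: "reading_word (R # T) = reading_word T @ R"
  by (simp add: reading_word_def)

text \<open>Lower rows come first in the reading word. A letter bumped to the front of its row
  therefore stands right after the word of the rows below, into which it is inserted next.\<close>

lemma knuth_row_insert:
  "\<forall>R\<in>set T. sorted R \<Longrightarrow> knuth (reading_word T @ [x]) (reading_word (row_insert x T))"
proof (induction T arbitrary: x)
  case (Cons R T)
  show ?case
  proof (cases rule: row_bump_cases[of R x])
    case None
    then show ?thesis by simp
  next
    case (Some B z C)
    have "knuth (reading_word T @ (R @ [x])) (reading_word T @ (z # B @ x # C))"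
      using Some Cons.prems by (intro knuth_append_left knuth_row_bump) auto
    moreover have "knuth ((reading_word T @ [z]) @ B @ x # C) (reading_word (row_insert z T) @ B @ x # C)"
      using Cons by (intro knuth_append_right) auto
    ultimately show ?thesis using Some knuth_trans by simp
  qed
qed simp

lemma tableau_insert_word: "tableau T \<Longrightarrow> tableau (fold row_insert w T)"
  by (induction w arbitrary: T) (auto simp: tableau_row_insert)

lemma tableau_insertion_tableau: "tableau (insertion_tableau w)"
  unfolding insertion_tableau_def by (simp add: tableau_insert_word)

lemma tableau_sorted: "tableau T \<Longrightarrow> \<forall>R\<in>set T. sorted R"
  by (simp add: tableau_def)

lemma knuth_reading_insertion: "knuth w (reading_word (insertion_tableau w))"
proof (induction w rule: rev_induct)
  case Nil
  then show ?case by (simp add: insertion_tableau_def)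
next
  case (snoc x w)
  have "knuth (w @ [x]) (reading_word (insertion_tableau w) @ [x])"
    using snoc knuth_append_right by blast
  also have "knuth \<dots> (reading_word (row_insert x (insertion_tableau w)))"
    by (intro knuth_row_insert tableau_sorted tableau_insertion_tableau)
  finally show ?case by (simp add: insertion_tableau_def)
qed

section \<open>Invariance of the insertion tableau under Knuth equivalence\<close>

text \<open>The second component is the word of bumped letters in order of bumping, which is then
  inserted into the remaining rows.\<close>

fun row_bump_word :: "nat list \<Rightarrow> nat list \<Rightarrow> nat list \<times> nat list" where
  "row_bump_word [] R = (R, [])"
| "row_bump_word (x # w) R =
     (case row_bump x R of (R', b) \<Rightarrow>
        case row_bump_word w R' of (R'', v) \<Rightarrow> (R'', (case b of None \<Rightarrow> [] | Some z \<Rightarrow> [z]) @ v))"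

lemma fold_row_insert_Cons:
  "fold row_insert w (R # T) =
     (case row_bump_word w R of (R', v) \<Rightarrow> R' # fold row_insert v T)"
  by (induction w arbitrary: R T) (auto split: prod.splits option.splits)

lemma row_bump_word_append_row:
  "\<forall>x\<in>set w. \<forall>y\<in>set R. y \<le> x \<Longrightarrow>
     row_bump_word w (R @ S) = (case row_bump_word w S of (S', v) \<Rightarrow> (R @ S', v))"
proof (induction w arbitrary: S)
  case (Cons x w)
  then show ?case by (auto simp: row_bump_append split: prod.splits)
qed simp

text \<open>Elementary relations without context. Up to direction they are inherited by the bumped
  words, which allows an induction over rows; the reflexive case covers bumped words that
  coincide.\<close>

inductive knuth1 :: "nat list \<Rightarrow> nat list \<Rightarrow> bool" where
  "knuth1 u u"
| "x < y \<Longrightarrow> y \<le> z \<Longrightarrow> knuth1 [y, x, z] [y, z, x]"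
| "x \<le> y \<Longrightarrow> y < z \<Longrightarrow> knuth1 [x, z, y] [z, x, y]"

lemma row_bump_word_yzx:
  assumes "sorted R" "x < y" "y \<le> z"
  shows "\<exists>R' v v'. row_bump_word [y, x, z] R = (R', v) \<and> row_bump_word [y, z, x] R = (R', v') \<and> knuth1 v v'"
proof -
  show ?thesis using assms(1)
  proof (induction R)
    case Nil
    then show ?case using assms(2,3) by (auto intro: knuth1.intros)
  next
    case (Cons r R)
    consider "r \<le> x" | "x < r" "r \<le> y" | "y < r" by linarith
    then show ?case
    proof cases
      case 1
      then show ?thesis using Cons assms(2,3) row_bump_word_append_row[of "[y, x, z]" "[r]" R]
          row_bump_word_append_row[of "[y, z, x]" "[r]" R]
        by auto
    next
      case 2
      obtain R1 b1 where 3: "row_bump y R = (R1, b1)" by fastforce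
      obtain R2 b2 where 4: "row_bump z R1 = (R2, b2)" by fastforce
      \<comment> \<open>Here \<open>x\<close> bumps \<open>r\<close>, while \<open>y\<close> and
        \<open>z\<close> go on to \<open>R\<close>. The bumped words are \<open>b1 r b2\<close> and
        \<open>b1 b2 r\<close>; they agree if \<open>b2\<close> is empty, and otherwise
        \<open>r < y' \<le> z'\<close> is needed.\<close>
      have b: "b2 = None \<or> (\<exists>y' z'. b1 = Some y' \<and> b2 = Some z' \<and> y < y' \<and> y' \<le> z')"
      proof (cases rule: row_bump_cases[of R y])
        case None
        then have "row_bump z (R @ [y]) = ((R @ [y]) @ [z], None)"
          using assms by (intro row_bump_None) auto
        then show ?thesis using None 3 4 by auto
      next
        case (Some B y' C)
        note outer = Some
        then have *: "row_bump z (B @ y # C) = (case row_bump z C of (S', b) \<Rightarrow> ((B @ [y]) @ S', b))"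
          using assms row_bump_append[of "B @ [y]" z C] by fastforce
        show ?thesis
        proof (cases rule: row_bump_cases[of C z])
          case None
          then show ?thesis using * Some 3 4 by auto
        next
          case (Some B' z' C')
          then have "y' \<le> z'" using Cons.prems outer by (auto simp: sorted_append)
          then show ?thesis using * Some outer 3 4 by auto
        qed
      qed
      have "row_bump_word [y, x, z] (r # R) = (x # R2, (case b1 of None \<Rightarrow> [] | Some u \<Rightarrow> [u]) @ [r] @ (case b2 of None \<Rightarrow> [] | Some u \<Rightarrow> [u]))"
        "row_bump_word [y, z, x] (r # R) = (x # R2, (case b1 of None \<Rightarrow> [] | Some u \<Rightarrow> [u]) @ (case b2 of None \<Rightarrow> [] | Some u \<Rightarrow> [u]) @ [r])"
        using 2 3 4 assms(2,3) by auto
      then show ?thesis using b 2 by (auto intro!: knuth1.intros)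
    next
      case 3
      obtain R2 b2 where 4: "row_bump z R = (R2, b2)" by fastforce
      have b: "\<forall>z'. b2 = Some z' \<longrightarrow> r \<le> z'"
        using 4 Cons.prems by (cases rule: row_bump_cases[of R z]) auto
      have "row_bump_word [y, x, z] (r # R) = (x # R2, [r, y] @ (case b2 of None \<Rightarrow> [] | Some u \<Rightarrow> [u]))"
        "row_bump_word [y, z, x] (r # R) = (x # R2, [r] @ (case b2 of None \<Rightarrow> [] | Some u \<Rightarrow> [u]) @ [y])"
        using 3 4 assms(2,3) by auto
      then show ?thesis using b 3 by (cases b2) (auto intro!: knuth1.intros)
    qed
  qed
qed

text \<open>The direction can flip: if \<open>z\<close> is less than all letters of a row starting
  with \<open>r q\<close>, the bumped words are \<open>r q z\<close> and \<open>r z q\<close>, an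
  instance of the other Knuth relation read backwards.\<close>

lemma row_bump_word_xzy:
  assumes "sorted R" "x \<le> y" "y < z"
  shows "\<exists>R' v v'. row_bump_word [x, z, y] R = (R', v) \<and> row_bump_word [z, x, y] R = (R', v') \<and>
    (knuth1 v v' \<or> knuth1 v' v)"
proof -
  show ?thesis using assms(1)
  proof (induction R)
    case Nil
    then show ?case using assms(2,3) by (auto intro: knuth1.intros)
  next
    case (Cons r R)
    have sR: "sorted R" "\<forall>q\<in>set R. r \<le> q" using Cons.prems by auto
    consider "r \<le> x" | "x < r" "r \<le> z" | "z < r" by linarith
    then show ?case
    proof cases
      case 1
      then show ?thesis using Cons assms(2,3) row_bump_word_append_row[of "[x, z, y]" "[r]" R]
          row_bump_word_append_row[of "[z, x, y]" "[r]" R]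
        by auto
    next
      case 2
      obtain R1 b1 where 3: "row_bump z R = (R1, b1)" by fastforce
      obtain R2 b2 where 4: "row_bump y R1 = (R2, b2)" by fastforce
      have z1: "z \<in> set R1" "sorted R1" "\<forall>q\<in>set R1. r \<le> q" "\<forall>z'. b1 = Some z' \<longrightarrow> z < z'"
        using 3 2 sR sorted_row_bump[of R z] by (cases rule: row_bump_cases[of R z]; auto)+
      obtain y' where b2: "b2 = Some y'" "r \<le> y'" "y' \<le> z"
      proof (cases rule: row_bump_cases[of R1 y])
        case None
        then show ?thesis using z1 assms(3) by auto
      next
        case (Some B y' C)
        then have "y' \<le> z" using z1 assms(3) by (auto simp: sorted_append)
        then show ?thesis using that[of y'] Some 4 z1 by auto
      qed
      have "row_bump_word [x, z, y] (r # R) = (x # R2, [r] @ (case b1 of None \<Rightarrow> [] | Some u \<Rightarrow> [u]) @ [y'])"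
        "row_bump_word [z, x, y] (r # R) = (x # R2, (case b1 of None \<Rightarrow> [] | Some u \<Rightarrow> [u]) @ [r] @ [y'])"
        using 2 3 4 assms(2,3) b2 by auto
      moreover have "\<forall>z'. b1 = Some z' \<longrightarrow> y' < z'" using z1 b2 by auto
      ultimately show ?thesis using b2 by (cases b1) (auto intro!: knuth1.intros)
    next
      case 3
      have zR: "\<forall>q\<in>set R. z < q" using sR 3 by auto
      show ?thesis
      proof (cases R)
        case Nil
        then show ?thesis using 3 assms(2,3) by (auto intro: knuth1.intros)
      next
        case (Cons q R')
        then show ?thesis using 3 assms(2,3) zR sR by (auto intro!: knuth1.intros)
      qed
    qed
  qed
qed

text \<open>Induction on rows: the first row becomes the same for both words, and the bumped words
  are again related.\<close>

lemma fold_row_insert_knuth1: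
  "\<forall>R\<in>set T. sorted R \<Longrightarrow> knuth1 u v \<Longrightarrow> fold row_insert u T = fold row_insert v T"
proof (induction T arbitrary: u v)
  case Nil
  from Nil.prems(2) show ?case by cases auto
next
  case (Cons R T)
  have "\<exists>R' w w'. row_bump_word u R = (R', w) \<and> row_bump_word v R = (R', w') \<and>
      (knuth1 w w' \<or> knuth1 w' w)"
    using Cons.prems(2)
  proof cases
    case 1
    then show ?thesis by (cases "row_bump_word u R") (auto intro: knuth1.intros)
  next
    case 2
    then show ?thesis using row_bump_word_yzx Cons.prems by fastforce
  next
    case 3
    then show ?thesis using row_bump_word_xzy Cons.prems by fastforce
  qed
  then show ?case using Cons.IH Cons.prems(1) by (force simp: fold_row_insert_Cons)
qed

lemma insertion_tableau_knuth: "knuth u v \<Longrightarrow> insertion_tableau u = insertion_tableau v"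
proof (induction rule: knuth.induct)
  case (knuth_yzx x y z u v)
  have "fold row_insert [y, x, z] (insertion_tableau u) = fold row_insert [y, z, x] (insertion_tableau u)"
    using knuth_yzx by (intro fold_row_insert_knuth1 tableau_sorted tableau_insertion_tableau knuth1.intros)
  then show ?case unfolding insertion_tableau_def by (simp only: fold_append comp_apply)
next
  case (knuth_xzy x y z u v)
  have "fold row_insert [x, z, y] (insertion_tableau u) = fold row_insert [z, x, y] (insertion_tableau u)"
    using knuth_xzy by (intro fold_row_insert_knuth1 tableau_sorted tableau_insertion_tableau knuth1.intros)
  then show ?case unfolding insertion_tableau_def by (simp only: fold_append comp_apply)
qed auto

lemma knuth_mset: "knuth u v \<Longrightarrow> mset u = mset v"
  by (induction rule: knuth.induct) auto

lemma knuth_set: "knuth u v \<Longrightarrow> set u = set v"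
  using knuth_mset mset_eq_setD by blast

section \<open>Evacuation as reversal and complement of words\<close>

definition rev_complement :: "nat \<Rightarrow> nat list \<Rightarrow> nat list" where
  "rev_complement r w = rev (map (\<lambda>x. r + 1 - x) w)"

text \<open>Reversal and complement exchange the two Knuth relations. The bound on the letters makes
  the truncated subtraction strictly order-reversing.\<close>

lemma knuth_rev_complement:
  "knuth u v \<Longrightarrow> set u \<subseteq> {1..r} \<Longrightarrow> knuth (rev_complement r u) (rev_complement r v)"
proof (induction rule: knuth.induct)
  case (knuth_sym u v)
  then show ?case using knuth_set knuth.knuth_sym by blast
next
  case (knuth_trans u v w)
  then show ?case using knuth_set knuth.knuth_trans by metis
next
  case (knuth_yzx x y z u v)
  then have "knuth (rev_complement r v @ [r + 1 - z, r + 1 - x, r + 1 - y] @ rev_complement r u)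
     (rev_complement r v @ [r + 1 - x, r + 1 - z, r + 1 - y] @ rev_complement r u)"
    by (intro knuth.knuth_xzy) auto
  then show ?case using knuth.knuth_sym by (simp add: rev_complement_def)
next
  case (knuth_xzy x y z u v)
  then have "knuth (rev_complement r v @ [r + 1 - y, r + 1 - z, r + 1 - x] @ rev_complement r u)
     (rev_complement r v @ [r + 1 - y, r + 1 - x, r + 1 - z] @ rev_complement r u)"
    by (intro knuth.knuth_yzx) auto
  then show ?case using knuth.knuth_sym by (simp add: rev_complement_def)
qed auto

text \<open>A word is Knuth equivalent to the reading word of its insertion tableau, so evacuation
  may be computed from any word with that tableau, in particular from the lower word of a
  biword.\<close>

lemma ev_insertion_tableau:
  assumes "set w \<subseteq> {1..r}"
  shows "ev r (insertion_tableau w) = insertion_tableau (rev_complement r w)"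
  unfolding ev_def rev_complement_def[symmetric]
  using knuth_reading_insertion knuth_rev_complement assms insertion_tableau_knuth by metis

subsection \<open>Strictly decreasing subwords\<close>

definition dec_above :: "nat \<Rightarrow> nat list \<Rightarrow> nat list set" where
  "dec_above b u = {w \<in> decreasing_subwords u. \<forall>x\<in>set w. b \<le> x}"

definition depth :: "nat \<Rightarrow> nat list \<Rightarrow> nat" where
  "depth b u = Max (length ` dec_above b u)"

lemma dec_above_iff:
  "w \<in> dec_above b u \<longleftrightarrow> subseq w u \<and> sorted_wrt (>) w \<and> (\<forall>x\<in>set w. b \<le> x)"
  by (auto simp: dec_above_def decreasing_subwords_def)

lemma finite_decreasing_subwords: "finite (decreasing_subwords u)"
proof -
  have "decreasing_subwords u \<subseteq> set (subseqs u)" by (auto simp: decreasing_subwords_def)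
  then show ?thesis using finite_subset by blast
qed

lemma finite_dec_above: "finite (dec_above b u)"
  using finite_decreasing_subwords by (simp add: dec_above_def)

lemma Nil_dec_above [simp]: "[] \<in> dec_above b u"
  by (simp add: dec_above_iff)

lemma length_le_depth: "w \<in> dec_above b u \<Longrightarrow> length w \<le> depth b u"
  unfolding depth_def using finite_dec_above by auto

lemma dec_above_Nil [simp]: "dec_above b [] = {[]}"
  by (auto simp: dec_above_iff list_emb_Nil2)

lemma depth_obtain: obtains w where "w \<in> dec_above b u" "length w = depth b u"
proof -
  have "depth b u \<in> length ` dec_above b u"
    unfolding depth_def using finite_dec_above Nil_dec_above by (intro Max_in) blast+
  then show thesis using that by auto
qed

lemma depth_leI: "(\<And>w. w \<in> dec_above b u \<Longrightarrow> length w \<le> d) \<Longrightarrow> depth b u \<le> d"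
  by (metis depth_obtain)

lemma dec_above_mono: "subseq u v \<Longrightarrow> w \<in> dec_above b u \<Longrightarrow> w \<in> dec_above b v"
  unfolding dec_above_iff using subseq_order.order_trans by blast

lemma depth_mono: "subseq u v \<Longrightarrow> depth b u \<le> depth b v"
  by (meson depth_leI dec_above_mono length_le_depth)

lemma dec_above_append:
  "w \<in> dec_above b (u @ v) \<longleftrightarrow> (\<exists>w1 w2. w = w1 @ w2 \<and> w1 \<in> dec_above b u \<and> w2 \<in> dec_above b v \<and>
     (\<forall>x\<in>set w1. \<forall>y\<in>set w2. y < x))"
  unfolding dec_above_iff subseq_append_iff by (fastforce simp: sorted_wrt_append)

lemma dec_above_appendI:
  "w1 \<in> dec_above b u \<Longrightarrow> w2 \<in> dec_above b v \<Longrightarrow> \<forall>x\<in>set w1. \<forall>y\<in>set w2. y < x \<Longrightarrow>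
     w1 @ w2 \<in> dec_above b (u @ v)"
  unfolding dec_above_append by blast

lemma set_dec_above: "w \<in> dec_above b u \<Longrightarrow> set w \<subseteq> set u"
  unfolding dec_above_iff using notin_set_nthsI subseq_conv_nths by (metis set_nths_subset)

lemma subseq_small: "subseq w [x, y, z] \<longleftrightarrow> w \<in> {[], [x], [y], [z], [x, y], [x, z], [y, z], [x, y, z]}"
  by (simp only: in_set_subseqs[symmetric]) (auto simp: Let_def)

text \<open>Only \<open>z x\<close> is lost when passing to \<open>y x z\<close>, and
  \<open>y x\<close> replaces it. The clauses on \<open>c\<close> say that the replacement stays
  within the same bounds and thus fits into any context.\<close>

lemma dec_above_yzx:
  assumes "x < y" "y \<le> z" "w \<in> dec_above b [y, z, x]"
  shows "\<exists>w'\<in>dec_above b [y, x, z]. length w' = length w \<and>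
    (\<forall>c. (\<forall>q\<in>set w. q < c) \<longrightarrow> (\<forall>q\<in>set w'. q < c)) \<and> (\<forall>c. (\<forall>q\<in>set w. c < q) \<longrightarrow> (\<forall>q\<in>set w'. c < q))"
proof (cases "w = [z, x]")
  case True
  then show ?thesis using assms by (intro bexI[of _ "[y, x]"]) (auto simp: dec_above_iff)
next
  case False
  have "w \<in> {[], [y], [z], [x], [y, z], [y, x], [z, x], [y, z, x]}"
    using assms(3) unfolding dec_above_iff subseq_small by fast
  then have "w \<in> dec_above b [y, x, z]"
    using assms False by (elim insertE emptyE) (simp_all add: dec_above_iff)
  then show ?thesis by (intro bexI[of _ w]) simp_all
qed

text \<open>Again only \<open>z x\<close> is lost; here \<open>z y\<close> replaces it.\<close>

lemma dec_above_xzy: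
  assumes "x \<le> y" "y < z" "w \<in> dec_above b [z, x, y]"
  shows "\<exists>w'\<in>dec_above b [x, z, y]. length w' = length w \<and>
    (\<forall>c. (\<forall>q\<in>set w. q < c) \<longrightarrow> (\<forall>q\<in>set w'. q < c)) \<and> (\<forall>c. (\<forall>q\<in>set w. c < q) \<longrightarrow> (\<forall>q\<in>set w'. c < q))"
proof (cases "w = [z, x]")
  case True
  then show ?thesis using assms by (intro bexI[of _ "[z, y]"]) (auto simp: dec_above_iff)
next
  case False
  have "w \<in> {[], [z], [x], [y], [z, x], [z, y], [x, y], [z, x, y]}"
    using assms(3) unfolding dec_above_iff subseq_small by fast
  then have "w \<in> dec_above b [x, z, y]"
    using assms False by (elim insertE emptyE) (simp_all add: dec_above_iff)
  then show ?thesis by (intro bexI[of _ w]) simp_all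
qed

lemma dec_above_yxz:
  assumes "x < y" "y \<le> z" "w \<in> dec_above b [y, x, z]"
  shows "w \<in> dec_above b [y, z, x]"
proof -
  have "w \<in> {[], [x], [y], [z], [y, x], [y, z], [x, z], [y, x, z]}"
    using assms(3) unfolding dec_above_iff subseq_small by fast
  then show ?thesis using assms by (elim insertE emptyE) (simp_all add: dec_above_iff)
qed

lemma dec_above_xzy':
  assumes "x \<le> y" "y < z" "w \<in> dec_above b [x, z, y]"
  shows "w \<in> dec_above b [z, x, y]"
proof -
  have "w \<in> {[], [x], [y], [z], [x, z], [x, y], [z, y], [x, z, y]}"
    using assms(3) unfolding dec_above_iff subseq_small by fast
  then show ?thesis using assms by (elim insertE emptyE) (simp_all add: dec_above_iff)
qed

text \<open>The parts of a decreasing subword before and after the middle factor constrain its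
  middle part only by an upper and a lower bound, which the replacement respects.\<close>

lemma depth_context_le:
  assumes "\<And>w. w \<in> dec_above b m \<Longrightarrow> \<exists>w'\<in>dec_above b m'. length w' = length w \<and>
    (\<forall>c. (\<forall>q\<in>set w. q < c) \<longrightarrow> (\<forall>q\<in>set w'. q < c)) \<and> (\<forall>c. (\<forall>q\<in>set w. c < q) \<longrightarrow> (\<forall>q\<in>set w'. c < q))"
  shows "depth b (u @ m @ v) \<le> depth b (u @ m' @ v)"
proof (rule depth_leI)
  fix w assume "w \<in> dec_above b (u @ m @ v)"
  then obtain w1 w23 where w1: "w = w1 @ w23" "w1 \<in> dec_above b u" "w23 \<in> dec_above b (m @ v)"
     "\<forall>x\<in>set w1. \<forall>y\<in>set w23. y < x"
    using dec_above_append[of w b u "m @ v"] by blast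
  obtain w2 w3 where w2: "w23 = w2 @ w3" "w2 \<in> dec_above b m" "w3 \<in> dec_above b v"
     "\<forall>x\<in>set w2. \<forall>y\<in>set w3. y < x"
    using dec_above_append[of w23 b m v] w1(3) by blast
  obtain w2' where w2': "w2' \<in> dec_above b m'" "length w2' = length w2"
    and lt: "\<forall>c. (\<forall>q\<in>set w2. q < c) \<longrightarrow> (\<forall>q\<in>set w2'. q < c)"
    and gt: "\<forall>c. (\<forall>q\<in>set w2. c < q) \<longrightarrow> (\<forall>q\<in>set w2'. c < q)"
    using assms[OF w2(2)] by blast
  have "\<forall>x\<in>set w2'. \<forall>y\<in>set w3. y < x" using gt w2(4) by simp
  then have "w2' @ w3 \<in> dec_above b (m' @ v)"
    by (intro dec_above_appendI w2'(1) w2(3))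
  moreover have "\<forall>x\<in>set w1. \<forall>y\<in>set (w2' @ w3). y < x"
    using w1(4) unfolding w2(1) set_append using lt by (metis Un_iff)
  ultimately have "w1 @ w2' @ w3 \<in> dec_above b (u @ m' @ v)"
    by (rule dec_above_appendI[OF w1(2)])
  then show "length w \<le> depth b (u @ m' @ v)" using length_le_depth w1(1) w2(1) w2'(2)
    by (metis length_append)
qed

lemma depth_mono_context:
  assumes "dec_above b m \<subseteq> dec_above b m'"
  shows "depth b (u @ m @ v) \<le> depth b (u @ m' @ v)"
proof (rule depth_context_le)
  fix w assume "w \<in> dec_above b m"
  then have "w \<in> dec_above b m'" using assms by blast
  then show "\<exists>w'\<in>dec_above b m'. length w' = length w \<and>
    (\<forall>c. (\<forall>q\<in>set w. q < c) \<longrightarrow> (\<forall>q\<in>set w'. q < c)) \<and> (\<forall>c. (\<forall>q\<in>set w. c < q) \<longrightarrow> (\<forall>q\<in>set w'. c < q))"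
    by (intro bexI[of _ w]) simp_all
qed

lemma depth_knuth: "knuth u v \<Longrightarrow> depth b u = depth b v"
proof (induction rule: knuth.induct)
  case (knuth_yzx x y z u v)
  show ?case
  proof (rule antisym)
    show "depth b (u @ [y, x, z] @ v) \<le> depth b (u @ [y, z, x] @ v)"
      using dec_above_yxz[OF knuth_yzx] by (intro depth_mono_context) blast
    show "depth b (u @ [y, z, x] @ v) \<le> depth b (u @ [y, x, z] @ v)"
      by (rule depth_context_le) (rule dec_above_yzx[OF knuth_yzx])
  qed
next
  case (knuth_xzy x y z u v)
  show ?case
  proof (rule antisym)
    show "depth b (u @ [x, z, y] @ v) \<le> depth b (u @ [z, x, y] @ v)"
      using dec_above_xzy'[OF knuth_xzy] by (intro depth_mono_context) blast
    show "depth b (u @ [z, x, y] @ v) \<le> depth b (u @ [x, z, y] @ v)"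
      by (rule depth_context_le) (rule dec_above_xzy[OF knuth_xzy])
  qed
qed auto

lemma dec_above_small: "x < b \<Longrightarrow> w \<in> dec_above b [x] \<longleftrightarrow> w = []"
  by (cases w) (auto simp: dec_above_iff dest: subseq_Cons2')

lemma depth_snoc_small:
  assumes "x < b" shows "depth b (u @ [x]) = depth b u"
proof (rule antisym)
  show "depth b (u @ [x]) \<le> depth b u"
    by (rule depth_leI) (auto simp: dec_above_append dec_above_small[OF assms] intro: length_le_depth)
qed (simp add: depth_mono subseq_rev_drop_many)

subsection \<open>Depth of the right part of a tableau\<close>

text \<open>Rows that become empty are kept, in contrast to \<open>columns_from\<close>. The word is
  the same, and insertion can be compared with \<open>map (drop r)\<close> as an identity of lists
  of rows (\<open>map_drop_row_insert\<close>).\<close>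

definition tail_word :: "nat \<Rightarrow> nat list list \<Rightarrow> nat list" where
  "tail_word r T = reading_word (map (drop r) T)"

definition tail_depth :: "nat \<Rightarrow> nat \<Rightarrow> nat list list \<Rightarrow> nat" where
  "tail_depth b r T = depth b (tail_word r T)"

definition col_height :: "nat \<Rightarrow> nat list list \<Rightarrow> nat" where
  "col_height r T = length (filter (\<lambda>R. r < length R) T)"

lemma tail_word_Nil [simp]: "tail_word r [] = []"
  by (simp add: tail_word_def)

lemma tail_word_Cons [simp]: "tail_word r (R # T) = tail_word r T @ drop r R"
  by (simp add: tail_word_def)

lemma tail_word_append [simp]: "tail_word r (T @ U) = tail_word r U @ tail_word r T"
  by (induction T) auto

lemma tail_word_empty: "\<forall>R\<in>set T. length R \<le> r \<Longrightarrow> tail_word r T = []"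
  by (induction T) auto

lemma col_height_Nil [simp]: "col_height r [] = 0"
  by (simp add: col_height_def)

lemma col_height_Cons [simp]:
  "col_height r (R # T) = (if r < length R then Suc (col_height r T) else col_height r T)"
  by (simp add: col_height_def)

lemma col_height_append [simp]: "col_height r (T @ U) = col_height r T + col_height r U"
  by (simp add: col_height_def)

lemma col_height_cong: "map length T = map length U \<Longrightarrow> col_height r T = col_height r U"
proof (induction T arbitrary: U)
  case (Cons R T)
  then show ?case by (cases U) auto
qed simp

lemma subseq_drop_mono: "r \<le> s \<Longrightarrow> subseq (drop s R) (drop r R)"
  by (metis le_add_diff_inverse2 drop_drop suffix_drop suffix_imp_subseq)

lemma subseq_tail_word: "r \<le> s \<Longrightarrow> subseq (tail_word s T) (tail_word r T)"
  by (induction T) (auto intro: list_emb_append_mono subseq_drop_mono)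

lemma tail_depth_antimono: "r \<le> s \<Longrightarrow> tail_depth b s T \<le> tail_depth b r T"
  unfolding tail_depth_def by (intro depth_mono subseq_tail_word)

lemma last_le_of_decreasing:
  assumes "v \<noteq> []" "sorted_wrt (>) (v :: nat list)" shows "\<forall>y\<in>set v. last v \<le> y"
  using assms by (cases v rule: rev_cases) (auto simp: sorted_wrt_append)

lemma dec_above_row:
  assumes "sorted R" "w \<in> dec_above b R"
  obtains "w = []" | x where "w = [x]" "x \<in> set R"
proof -
  have w: "sorted_wrt (>) w" "subseq w R" using assms(2) by (auto simp: dec_above_iff)
  have "sorted w" using assms(1) w(2) by (metis sorted_nths subseq_conv_nths)
  then have "length w \<le> 1"
  proof (cases w rule: list.exhaust)
    case (Cons x w')
    then show ?thesis using w(1) \<open>sorted w\<close> by (cases w') auto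
  qed simp
  moreover have "set w \<subseteq> set R" using set_dec_above assms(2) by blast
  ultimately show thesis using that by (cases w) auto
qed

text \<open>A weakly increasing row contributes at most one letter, and only if it reaches column
  \<open>r\<close>.\<close>

lemma length_dec_above_tail_word:
  "\<forall>R\<in>set T. sorted R \<Longrightarrow> w \<in> dec_above b (tail_word r T) \<Longrightarrow> length w \<le> col_height r T"
proof (induction T arbitrary: w)
  case Nil
  then show ?case by (simp add: dec_above_iff)
next
  case (Cons R T)
  then obtain w1 w2 where w: "w = w1 @ w2" "w1 \<in> dec_above b (tail_word r T)" "w2 \<in> dec_above b (drop r R)"
    by (auto simp: dec_above_append)
  have "length w1 \<le> col_height r T" using Cons w by auto
  moreover have "sorted (drop r R)" using Cons.prems(1) by (simp add: sorted_wrt_drop)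
  then have "length w2 \<le> (if r < length R then 1 else 0)"
    using w(3) by (cases rule: dec_above_row) (auto intro: ccontr)
  ultimately show ?case using w(1) by (auto split: if_splits)
qed

lemma tail_depth_le_col_height: "tableau T \<Longrightarrow> tail_depth b r T \<le> col_height r T"
  unfolding tail_depth_def using length_dec_above_tail_word tableau_sorted by (intro depth_leI) blast

lemma in_set_drop_ge: "sorted R \<Longrightarrow> x \<in> set (drop s R) \<Longrightarrow> R ! s \<le> x"
  by (auto simp: in_set_conv_nth intro!: sorted_nth_mono)

lemma tableau_tail_gt:
  assumes "tableau (R # T)" "\<forall>S\<in>set T. s < length S" "x \<in> set (tail_word s T)"
  shows "R ! s < x"
proof -
  obtain S where S: "S \<in> set T" "x \<in> set (drop s S)"
    using assms(3) by (auto simp: tail_word_def reading_word_def)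
  then have "row_above R S" "sorted S" using assms(1) by (auto simp: tableau_def)
  then show ?thesis using S assms(2) in_set_drop_ge unfolding row_above_def
    by (metis less_le_trans)
qed

text \<open>Each letter left of column \<open>s\<close> is replaced by the letter of the same row in column \<open>s\<close>.\<close>

lemma dec_above_shift:
  assumes "tableau T" "\<forall>R\<in>set T. s < length R" "r \<le> s" "w \<in> dec_above b (tail_word r T)"
  shows "\<exists>w'\<in>dec_above b (tail_word s T). length w' = length w \<and> (w \<noteq> [] \<longrightarrow> last w \<le> last w')"
  using assms
proof (induction T arbitrary: w)
  case Nil
  then show ?case by (auto simp: dec_above_iff)
next
  case (Cons R T)
  have T: "tableau T" "sorted R" "s < length R" using Cons.prems by (auto simp: tableau_Cons)
  obtain w1 w2 where w: "w = w1 @ w2" "w1 \<in> dec_above b (tail_word r T)" "w2 \<in> dec_above b (drop r R)"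
     "\<forall>x\<in>set w1. \<forall>y\<in>set w2. y < x"
    using Cons.prems by (auto simp: dec_above_append)
  obtain w1' where w1': "w1' \<in> dec_above b (tail_word s T)" "length w1' = length w1" "w1 \<noteq> [] \<longrightarrow> last w1 \<le> last w1'"
    using Cons.IH[OF T(1) _ \<open>r \<le> s\<close> w(2)] Cons.prems by auto
  have "sorted (drop r R)" using T by (simp add: sorted_wrt_drop)
  then show ?case using w(3)
  proof (cases rule: dec_above_row)
    case 1
    then show ?thesis using w1' w(1)
      using dec_above_mono[OF subseq_rev_drop_many[OF subseq_order.order_refl]]
      by (intro bexI[of _ w1']) auto
  next
    case (2 x)
    \<comment> \<open>If \<open>x\<close> occurs in column \<open>s\<close> or to its right, it is
      kept; otherwise \<open>x'\<close> is the entry in column \<open>s\<close>.\<close>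
    define x' where "x' = max x (R ! s)"
    have x': "x' \<in> set (drop s R)"
    proof (cases "x \<in> set (drop s R)")
      case True
      then show ?thesis using in_set_drop_ge[OF T(2)] by (simp add: x'_def max_absorb1)
    next
      case False
      have "x \<in> set R" using 2 by (meson in_set_dropD)
      then obtain j where j: "j < length R" "x = R ! j" by (auto simp: in_set_conv_nth)
      have "j < s"
      proof (rule ccontr)
        assume "\<not> j < s"
        then have "drop s R ! (j - s) = x" "j - s < length (drop s R)" using j by auto
        then show False using False nth_mem by metis
      qed
      then have "x' = R ! s" using j T by (simp add: x'_def max_absorb2 sorted_nth_mono)
      then show ?thesis using T(3) by (metis Cons_nth_drop_Suc list.set_intros(1))
    qed
    \<comment> \<open>The clause on last letters is needed here:
      \<open>x < last w1 \<le> last w1' \<le> y\<close>. The column condition gives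
      \<open>R ! s < y\<close>.\<close>
    have gt: "\<forall>y\<in>set w1'. x' < y"
    proof
      fix y assume y: "y \<in> set w1'"
      then have ne: "w1' \<noteq> []" "w1 \<noteq> []" using w1' by auto
      have "sorted_wrt (>) w1'" using w1' by (simp add: dec_above_iff)
      then have "last w1' \<le> y" using y ne
        by (metis last_le_of_decreasing)
      moreover have "x < last w1" using w(4) 2 ne by simp
      moreover have "R ! s < y" using tableau_tail_gt[OF Cons.prems(1)] Cons.prems(2) y w1' set_dec_above by fastforce
      ultimately show "x' < y" using w1' ne by (auto simp: x'_def)
    qed
    have "b \<le> x'" using w(3) 2 by (auto simp: dec_above_iff x'_def)
    then have "[x'] \<in> dec_above b (drop s R)" using x' by (simp add: dec_above_iff subseq_singleton_left)
    then have "w1' @ [x'] \<in> dec_above b (tail_word s (R # T))"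
      using dec_above_appendI[OF w1'(1), of "[x']" "drop s R"] gt by simp
    then show ?thesis using 2 w w1' by (intro bexI[of _ "w1' @ [x']"]) (auto simp: x'_def)
  qed
qed

lemma tableau_append:
  "tableau (T @ U) \<longleftrightarrow> tableau T \<and> tableau U \<and> (\<forall>R\<in>set T. \<forall>S\<in>set U. row_above R S)"
  by (auto simp: tableau_def sorted_wrt_append)

lemma tableau_split_col:
  assumes "tableau T"
  obtains U D where "T = U @ D" "\<forall>R\<in>set U. s < length R" "\<forall>R\<in>set D. length R \<le> s"
proof -
  have "\<exists>U D. T = U @ D \<and> (\<forall>R\<in>set U. s < length R) \<and> (\<forall>R\<in>set D. length R \<le> s)"
    using assms
  proof (induction T)
    case (Cons R T)
    then have T: "tableau T" "\<forall>S\<in>set T. length S \<le> length R"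
      by (auto simp: tableau_def row_above_def)
    show ?case
    proof (cases "s < length R")
      case True
      obtain U D where "T = U @ D \<and> (\<forall>R\<in>set U. s < length R) \<and> (\<forall>R\<in>set D. length R \<le> s)"
        using Cons.IH T(1) by blast
      then show ?thesis using True by (intro exI[of _ "R # U"] exI[of _ D]) auto
    next
      case False
      then show ?thesis using T(2) by (intro exI[of _ "[]"] exI[of _ "R # T"]) auto
    qed
  qed simp
  then show thesis using that by blast
qed

lemma col_height_all: "\<forall>R\<in>set U. s < length R \<Longrightarrow> col_height s U = length U"
  by (simp add: col_height_def)

lemma col_height_none: "\<forall>R\<in>set U. length R \<le> s \<Longrightarrow> col_height s U = 0"
  by (auto simp: col_height_def filter_empty_conv not_less)

text \<open>Letters in rows that reach column \<open>s\<close> can be shifted into the columns from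
  \<open>s\<close> on. The other rows that reach column \<open>r\<close> number
  \<open>col_height r T - col_height s T\<close> and contribute at most one letter each.\<close>

lemma tail_depth_col_height_mono:
  assumes "tableau T" "r \<le> s"
  shows "tail_depth b r T + col_height s T \<le> tail_depth b s T + col_height r T"
proof -
  obtain U D where UD: "T = U @ D" "\<forall>R\<in>set U. s < length R" "\<forall>R\<in>set D. length R \<le> s"
    using tableau_split_col assms(1) by blast
  then have t: "tableau U" "tableau D" using assms by (auto simp: tableau_append)
  have "\<forall>R\<in>set U. r < length R" using UD(2) assms(2) by auto
  then have h: "col_height s T = length U" "col_height r T = length U + col_height r D"
    using UD assms(2) col_height_all[of U s] col_height_all[of U r] col_height_none[of D s] by auto
  obtain w where w: "w \<in> dec_above b (tail_word r T)" "length w = tail_depth b r T"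
    unfolding tail_depth_def using depth_obtain by blast
  then obtain w1 w2 where w12: "w = w1 @ w2" "w1 \<in> dec_above b (tail_word r D)" "w2 \<in> dec_above b (tail_word r U)"
    using UD by (auto simp: dec_above_append)
  obtain w' where "w' \<in> dec_above b (tail_word s U)" "length w' = length w2"
    using dec_above_shift[OF t(1) UD(2) assms(2) w12(3)] by blast
  then have "length w2 \<le> depth b (tail_word s U)" using length_le_depth by fastforce
  also have "tail_word s U = tail_word s T" using UD tail_word_empty by simp
  finally have "length w2 \<le> tail_depth b s T" by (simp add: tail_depth_def)
  moreover have "length w1 \<le> col_height r D"
    using length_dec_above_tail_word w12(2) tableau_sorted[OF t(2)] by blast
  ultimately show ?thesis using h w w12 by simp
qed

subsection \<open>Depth under insertion\<close>

lemma tableau_len_mono: "tableau T \<Longrightarrow> i \<le> j \<Longrightarrow> j < length T \<Longrightarrow> length (T ! j) \<le> length (T ! i)"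
  unfolding tableau_def row_above_def by (cases "i = j") (auto simp: sorted_wrt_iff_nth_less)

text \<open>Treats both cases of \<open>add_to_row\<close> alike: \<open>R\<close> is the row that
  receives the cell, empty if that row is new.\<close>

lemma add_to_row_split:
  assumes "k \<le> length T" "s = (if k < length T then length (T ! k) else 0)"
  obtains R D where "length R = s" "set R \<subseteq> \<Union> (set ` set T)" "set D \<subseteq> set (drop k T)"
    "add_to_row k i T = take k T @ (R @ [i]) # D"
    "\<And>r. tail_word r T = tail_word r D @ drop r R @ tail_word r (take k T)"
    "\<And>r. col_height r T = col_height r (take k T) + (if r < s then 1 else 0) + col_height r D"
proof (cases "k < length T")
  case True
  define R D where "R = T ! k" and "D = drop (Suc k) T"
  have T: "T = take k T @ R # D" using True by (simp add: R_def D_def id_take_nth_drop)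
  have "add_to_row k i T = take k T @ (R @ [i]) # D"
    using True by (simp add: add_to_row_def R_def D_def upd_conv_take_nth_drop)
  moreover have "length R = s" using assms True by (simp add: R_def)
  moreover have "set R \<subseteq> \<Union> (set ` set T)" "set D \<subseteq> set (drop k T)"
    using True set_drop_subset_set_drop[of k "Suc k" T] by (auto simp: R_def D_def intro: nth_mem)
  moreover have "tail_word r T = tail_word r D @ drop r R @ tail_word r (take k T)" for r
    by (subst T, subst tail_word_append) simp
  moreover have "col_height r T = col_height r (take k T) + (if r < s then 1 else 0) + col_height r D" for r
    using \<open>length R = s\<close> by (subst T, subst col_height_append) simp
  ultimately show thesis using that by blast
next
  case False
  then show thesis using assms by (intro that[of "[]" "[]"]) (auto simp: add_to_row_def)
qed

lemma col_height_add_to_row: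
  assumes "k \<le> length T" "s = (if k < length T then length (T ! k) else 0)"
  shows "col_height r (add_to_row k i T) = col_height r T + (if r = s then 1 else 0)"
proof -
  obtain R D where "length R = s" "add_to_row k i T = take k T @ (R @ [i]) # D"
    "col_height r T = col_height r (take k T) + (if r < s then 1 else 0) + col_height r D"
    using add_to_row_split[OF assms, of i] by metis
  then show ?thesis by auto
qed

text \<open>Both shapes are tableau shapes, so the new cell is an outer corner. Only the shape of
  \<open>T'\<close> is compared, so the result applies to insertion as well as to recording.\<close>

lemma tableau_new_cell_rows:
  assumes "tableau T" "tableau T'" "map length T' = map length (add_to_row k i T)" "k \<le> length T"
    "s = (if k < length T then length (T ! k) else 0)"
  shows "\<forall>R\<in>set (take k T). s < length R" "\<forall>R\<in>set (drop k T). length R \<le> s"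
proof -
  obtain R D where RD: "length R = s" "add_to_row k i T = take k T @ (R @ [i]) # D"
    using add_to_row_split[OF assms(4,5), of i] by metis
  have len: "length T' = length (add_to_row k i T)" using assms(3) by (metis length_map)
  have nth: "length (T' ! j) = length (add_to_row k i T ! j)" if "j \<le> k" for j
  proof -
    have "j < length T'" using that len RD(2) assms(4) by simp
    then show ?thesis using assms(3) len by (metis nth_map)
  qed
  have k: "length (T' ! k) = Suc s" using nth[of k] RD assms(4) by (simp add: nth_append)
  show "\<forall>R\<in>set (take k T). s < length R"
  proof
    fix S assume "S \<in> set (take k T)"
    then obtain j where j: "j < k" "S = T ! j" using assms(4) by (auto simp: in_set_conv_nth)
    then have "length (T' ! j) = length S" using nth[of j] RD(2) assms(4) by (simp add: nth_append)
    moreover have "length (T' ! k) \<le> length (T' ! j)"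
      using j RD(2) len assms(4) by (intro tableau_len_mono[OF assms(2)]) auto
    ultimately show "s < length S" using k by simp
  qed
  show "\<forall>R\<in>set (drop k T). length R \<le> s"
  proof (cases "drop k T")
    case (Cons S D')
    then have "k < length T" by (metis drop_all linorder_not_le list.distinct(1))
    then have "T ! k = S" using Cons by (metis hd_drop_conv_nth list.sel(1))
    moreover have "tableau (drop k T)" using assms(1) by (metis append_take_drop_id tableau_append)
    ultimately show ?thesis using Cons assms(5) \<open>k < length T\<close> by (auto simp: tableau_def row_above_def)
  qed simp
qed

lemma col_height_new_cell:
  assumes "tableau T" "tableau T'" "map length T' = map length (add_to_row k i T)" "k \<le> length T"
    "s = (if k < length T then length (T ! k) else 0)"
  shows "col_height s T = k"
proof -
  have "col_height s T = col_height s (take k T) + col_height s (drop k T)"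
    by (metis append_take_drop_id col_height_append)
  also have "\<dots> = k" using tableau_new_cell_rows[OF assms] assms(4)
    by (simp add: col_height_all col_height_none)
  finally show ?thesis .
qed

text \<open>The label \<open>i\<close> is maximal, so a decreasing subword through it starts with it
  and continues in the rows above. These reach beyond column \<open>s\<close>, so the continuation
  can be shifted into the columns from \<open>s\<close> on. Conversely, \<open>i\<close> can precede
  any decreasing subword of the rows above, whose entries are smaller.\<close>

lemma tail_depth_add_to_row:
  assumes T: "tableau T" "tableau (add_to_row k i T)" "k \<le> length T"
    "s = (if k < length T then length (T ! k) else 0)"
    and le: "\<forall>R\<in>set T. \<forall>x\<in>set R. x \<le> i" and lt: "\<forall>R\<in>set (take k T). \<forall>x\<in>set R. x < i"
    and b: "b \<le> i"
  shows "tail_depth b r (add_to_row k i T) =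
    (if r \<le> s then max (tail_depth b r T) (Suc (tail_depth b s T)) else tail_depth b r T)"
proof -
  obtain R D where R: "length R = s" "set R \<subseteq> \<Union> (set ` set T)" "set D \<subseteq> set (drop k T)"
    and Q: "add_to_row k i T = take k T @ (R @ [i]) # D"
    and tw: "\<And>r. tail_word r T = tail_word r D @ drop r R @ tail_word r (take k T)"
    using add_to_row_split[OF T(3,4), of i] by metis
  have tw': "tail_word r (add_to_row k i T) = tail_word r D @ drop r (R @ [i]) @ tail_word r (take k T)" for r
    by (simp add: Q)
  show ?thesis
  proof (cases "r \<le> s")
    case False
    then show ?thesis using R(1) by (simp add: tail_depth_def tw tw')
  next
    case True
    let ?U = "take k T"
    have long: "\<forall>R\<in>set ?U. s < length R" using tableau_new_cell_rows(1)[OF T(1,2) refl T(3,4)] by blast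
    have tU: "tableau ?U" using T(1) by (metis append_take_drop_id tableau_append)
    have "\<forall>S\<in>set D. length S \<le> s"
      using tableau_new_cell_rows(2)[OF T(1,2) refl T(3,4)] R(3) by blast
    then have twD: "tail_word s T = tail_word s ?U"
      using R(1) by (simp add: tw tail_word_empty)
    have w': "tail_word r (add_to_row k i T) = (tail_word r D @ drop r R) @ [i] @ tail_word r ?U"
      using True R(1) by (simp add: tw')
    have set_small: "\<forall>x\<in>set (tail_word r T). x \<le> i"
      using le by (auto simp: tail_word_def reading_word_def dest: in_set_dropD)
    have "tail_depth b r (add_to_row k i T) = max (tail_depth b r T) (Suc (tail_depth b s T))"
    proof (rule antisym)
      show "tail_depth b r (add_to_row k i T) \<le> max (tail_depth b r T) (Suc (tail_depth b s T))"
        unfolding tail_depth_def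
      proof (rule depth_leI)
        fix w assume "w \<in> dec_above b (tail_word r (add_to_row k i T))"
        then obtain w1 w23 where w1: "w = w1 @ w23" "w1 \<in> dec_above b (tail_word r D @ drop r R)"
          "w23 \<in> dec_above b ([i] @ tail_word r ?U)" "\<forall>x\<in>set w1. \<forall>y\<in>set w23. y < x"
          unfolding w' dec_above_append[of w] by blast
        then obtain w2 w3 where w2: "w23 = w2 @ w3" "w2 \<in> dec_above b [i]" "w3 \<in> dec_above b (tail_word r ?U)"
          unfolding dec_above_append[of w23] by blast
        have "w2 = [] \<or> w2 = [i]"
          by (rule dec_above_row[OF _ w2(2)]) auto
        then show "length w \<le> max (depth b (tail_word r T)) (Suc (depth b (tail_word s T)))"
        proof
          assume "w2 = []"
          then have "w1 @ w3 \<in> dec_above b ((tail_word r D @ drop r R) @ tail_word r ?U)"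
            using w1 w2 by (intro dec_above_appendI) auto
          then have "length (w1 @ w3) \<le> depth b (tail_word r T)"
            by (intro length_le_depth) (simp add: tw)
          then show ?thesis using \<open>w2 = []\<close> w1 w2 by simp
        next
          assume i: "w2 = [i]"
          have "w1 = []"
          proof (rule ccontr)
            assume "w1 \<noteq> []"
            then obtain x where x: "x \<in> set w1" by (meson last_in_set)
            then have "x \<in> set (tail_word r T)" using set_dec_above[OF w1(2)] by (auto simp: tw)
            moreover have "i < x" using w1(4) w2(1) i x by simp
            ultimately show False using set_small by fastforce
          qed
          obtain w3' where "w3' \<in> dec_above b (tail_word s ?U)" "length w3' = length w3"
            using dec_above_shift[OF tU long True w2(3)] by blast
          then have "length w3 \<le> depth b (tail_word s T)" using length_le_depth twD by metis
          then show ?thesis using \<open>w1 = []\<close> w1 w2 i by simp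
        qed
      qed
      have "tail_depth b r T \<le> tail_depth b r (add_to_row k i T)"
        unfolding tail_depth_def tw w'
        by (intro depth_mono) (auto simp: subseq_append' intro: list_emb_Cons)
      moreover have "Suc (tail_depth b s T) \<le> tail_depth b r (add_to_row k i T)"
      proof -
        obtain w where w: "w \<in> dec_above b (tail_word s ?U)" "length w = tail_depth b s T"
          unfolding tail_depth_def twD using depth_obtain by blast
        have "\<forall>x\<in>set (tail_word s ?U). x < i"
          using lt by (auto simp: tail_word_def reading_word_def dest: in_set_dropD)
        then have "[i] @ w \<in> dec_above b ([i] @ tail_word s ?U)"
          using w set_dec_above[OF w(1)] b by (intro dec_above_appendI) (auto simp: dec_above_iff)
        then have "[i] @ w \<in> dec_above b (tail_word r (add_to_row k i T))"
          unfolding w' using subseq_tail_word[OF True, of ?U]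
          by (elim dec_above_mono[rotated]) (simp add: subseq_drop_many)
        from length_le_depth[OF this] show ?thesis using w(2) by (simp add: tail_depth_def)
      qed
      ultimately show "max (tail_depth b r T) (Suc (tail_depth b s T)) \<le> tail_depth b r (add_to_row k i T)"
        by simp
    qed
    then show ?thesis using True by simp
  qed
qed

section \<open>Effect of row insertion on heights and depths\<close>

lemma col_height_row_insert:
  assumes "tableau T"
  shows "col_height r (row_insert x T) = col_height r T + (if r = new_cell_col x T then 1 else 0)"
  using col_height_add_to_row[OF new_cell_row_le, of "new_cell_col x T" x T r x]
    col_height_cong[OF shape_row_insert[of x T x]] by (simp add: new_cell_col_def)

lemma col_height_new_cell_col: "tableau T \<Longrightarrow> col_height (new_cell_col x T) T = new_cell_row x T"
  by (rule col_height_new_cell[OF _ tableau_row_insert shape_row_insert new_cell_row_le])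
    (simp_all add: new_cell_col_def)

lemma tail_word_insert_left:
  "tableau (R # T) \<Longrightarrow> bump_pos x R < r \<Longrightarrow> tail_word r (row_insert x (R # T)) = tail_word r (R # T)"
proof (induction T arbitrary: x R)
  case Nil
  show ?case
  proof (cases rule: row_bump_cases[of R x])
    case None
    then show ?thesis using Nil by (simp add: bump_pos_None)
  next
    case (Some B z C)
    then show ?thesis using Nil bump_pos_Some[of B x z C] by (simp add: drop_Cons')
  qed
next
  case (Cons S T)
  then have T: "tableau (S # T)" "row_above R S" by (auto simp: tableau_Cons)
  show ?case
  proof (cases rule: row_bump_cases[of R x])
    case None
    then show ?thesis using Cons.prems by (simp add: bump_pos_None)
  next
    case (Some B z C)
    then have p: "bump_pos x R = length B" using bump_pos_Some by simp
    then have "bump_pos z S < r" using bump_pos_left T(2) Some(1) Cons.prems(2) by (metis le_less_trans)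
    then have "tail_word r (row_insert z (S # T)) = tail_word r (S # T)" using Cons.IH T(1) by blast
    then show ?thesis using Some p Cons.prems(2)
      by (simp del: row_insert.simps(2) add: row_insert_bump_Some drop_Cons')
  qed
qed

text \<open>The path never goes left of the new cell, so the insertion takes place entirely inside
  \<open>T\<^sub>r\<close>.\<close>

lemma map_drop_row_insert:
  "tableau T \<Longrightarrow> r \<le> new_cell_col x T \<Longrightarrow> map (drop r) (row_insert x T) = row_insert x (map (drop r) T)"
proof (induction T arbitrary: x)
  case Nil
  then show ?case by simp
next
  case (Cons R T)
  have r: "r \<le> bump_pos x R" using new_cell_col_le_bump_pos[OF Cons.prems(1), of x] Cons.prems(2) by linarith
  show ?case
  proof (cases rule: row_bump_cases[of R x])
    case None
    then have "row_bump x (drop r R) = (drop r R @ [x], None)"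
      by (intro row_bump_None) (auto dest: in_set_dropD)
    then show ?thesis using None r by (simp add: bump_pos_None)
  next
    case (Some B z C)
    then have p: "r \<le> length B" using r bump_pos_Some by simp
    have "row_bump x (drop r B @ z # C) = (drop r B @ x # C, Some z)"
      using Some by (intro row_bump_Some) (auto dest: in_set_dropD)
    moreover have "map (drop r) (row_insert z T) = row_insert z (map (drop r) T)"
      using Cons Some new_cell_col_Some by (metis tableau_Cons)
    ultimately show ?thesis using Some p by simp
  qed
qed

text \<open>The word \<open>v\<close> consists of the letters that the insertion places in the
  successive rows, read from bottom to top. Each bumped letter is larger than the one that bumps it,
  and all stand in columns from \<open>s\<close> on.\<close>

lemma bump_path:
  assumes "tableau T" "s = new_cell_col x T"
  shows "\<exists>v. length v = Suc (new_cell_row x T) \<and> sorted_wrt (>) v \<and> last v = x \<and>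
    subseq v (tail_word s (row_insert x T))"
  using assms
proof (induction T arbitrary: x)
  case Nil
  then show ?case by (intro exI[of _ "[x]"]) simp
next
  case (Cons R T)
  have s: "s \<le> bump_pos x R" using new_cell_col_le_bump_pos[OF Cons.prems(1), of x] Cons.prems(2) by linarith
  show ?case
  proof (cases rule: row_bump_cases[of R x])
    case None
    then show ?thesis using s by (intro exI[of _ "[x]"]) (simp add: bump_pos_None subseq_singleton_left)
  next
    case (Some B z C)
    then have p: "s \<le> length B" using s bump_pos_Some by simp
    obtain v where v: "length v = Suc (new_cell_row z T)" "sorted_wrt (>) v" "last v = z"
      "subseq v (tail_word s (row_insert z T))"
      using Cons.IH[of z] Cons.prems Some new_cell_col_Some by (metis tableau_Cons)
    have "v \<noteq> []" using v(1) by auto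
    then have "\<forall>y\<in>set v. z \<le> y" using v(2) unfolding v(3)[symmetric] by (rule last_le_of_decreasing)
    then have "sorted_wrt (>) (v @ [x])" using v(2) Some(3) by (auto simp: sorted_wrt_append)
    moreover have "subseq (v @ [x]) (tail_word s (row_insert x (R # T)))"
      using v(4) Some p by (auto intro!: list_emb_append_mono simp: subseq_singleton_left)
    ultimately show ?thesis using v(1) Some by (intro exI[of _ "v @ [x]"]) simp
  qed
qed

text \<open>
  To the right of the new cell the bumping path is seen only in the top \<open>k\<close> rows, whose letters
  change from \<open>u\<close> to \<open>u1\<close>; it leaves them with the letter \<open>y\<close>.
\<close>

lemma tail_word_insert_right:
  assumes "tableau T" "s = new_cell_col x T" "s < r"
  shows "\<exists>k l u u1 y v. tail_word r T = l @ u \<and> tail_word r (row_insert x T) = l @ u1 \<and>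
     knuth (u @ [x]) (y # u1) \<and> (\<forall>b. \<forall>c\<in>dec_above b l. length c + k \<le> col_height r T) \<and>
     length v + k = Suc (new_cell_row x T) \<and> sorted_wrt (>) v \<and> v \<noteq> [] \<and> last v = y \<and>
     subseq (v @ u1) (tail_word s (row_insert x T))"
  using assms
proof (induction T arbitrary: x)
  case Nil
  then show ?case
    by (intro exI[of _ 0] exI[of _ "[]"] exI[of _ x] exI[of _ "[x]"]) auto
next
  case (Cons R T)
  show ?case
  proof (cases "bump_pos x R < r")
    case True
    \<comment> \<open>The path enters left of column \<open>r\<close> and is not seen there:
      \<open>k = 0\<close>, \<open>l\<close> is the whole word, \<open>u\<close> and
      \<open>u1\<close> are empty, and \<open>v\<close> is the full path.\<close>
    then have *: "tail_word r (row_insert x (R # T)) = tail_word r (R # T)"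
      using tail_word_insert_left Cons.prems(1) by blast
    obtain v where v: "length v = Suc (new_cell_row x (R # T))" "sorted_wrt (>) v" "last v = x"
      "subseq v (tail_word s (row_insert x (R # T)))"
      using bump_path[OF Cons.prems(1,2)] by blast
    have "\<forall>b. \<forall>c\<in>dec_above b (tail_word r (R # T)). length c + 0 \<le> col_height r (R # T)"
      using length_dec_above_tail_word[OF tableau_sorted[OF Cons.prems(1)]] by simp
    moreover have "v \<noteq> []" using v(1) by auto
    ultimately show ?thesis using * v
      by (intro exI[of _ 0] exI[of _ "tail_word r (R # T)"] exI[of _ "[]"] exI[of _ x] exI[of _ v])
        (simp del: row_insert.simps new_cell_row.simps tail_word_Cons col_height_Cons)
  next
    case False
    show ?thesis
    proof (cases rule: row_bump_cases[of R x])
      case None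
      then show ?thesis using Cons.prems(2,3) False by (simp add: bump_pos_None new_cell_col_None)
    next
      case (Some B z C)
      then have p: "r \<le> length B" using False bump_pos_Some by simp
      have T: "tableau T" "s = new_cell_col z T" "sorted R" using Cons.prems Some new_cell_col_Some
        by (auto simp: tableau_Cons)
      obtain k l u u1 y v where IH: "tail_word r T = l @ u" "tail_word r (row_insert z T) = l @ u1"
         "knuth (u @ [z]) (y # u1)" "\<forall>b. \<forall>c\<in>dec_above b l. length c + k \<le> col_height r T"
         "length v + k = Suc (new_cell_row z T)" "sorted_wrt (>) v" "v \<noteq> []" "last v = y"
         "subseq (v @ u1) (tail_word s (row_insert z T))"
        using Cons.IH[OF T(1,2) Cons.prems(3)] by blast
      have row: "row_bump x (drop r R) = (drop r B @ x # C, Some z)"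
        using Some p row_bump_Some[of "drop r B" x z C] by (auto dest: in_set_dropD)
      \<comment> \<open>In this row the path is visible, so the bump is a Knuth equivalence on
        \<open>drop r R\<close>; the bumped \<open>z\<close> is carried on by the induction
        hypothesis.\<close>
      have "knuth (u @ drop r R @ [x]) (u @ z # drop r B @ x # C)"
        using T(3) by (intro knuth_append_left knuth_row_bump row) (simp add: sorted_wrt_drop)
      also have "knuth \<dots> (y # u1 @ drop r B @ x # C)"
        using knuth_append_right[OF IH(3), of "drop r B @ x # C"] by simp
      finally have "knuth ((u @ drop r R) @ [x]) (y # u1 @ drop r B @ x # C)" by simp
      moreover have "subseq (v @ u1 @ drop r B @ x # C) (tail_word s (row_insert x (R # T)))"
        using list_emb_append_mono[OF IH(9), of "drop r B @ x # C" "drop s B @ x # C"] Some p Cons.prems(3)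
        by (simp add: subseq_drop_mono)
      moreover have "\<forall>b. \<forall>c\<in>dec_above b l. length c + Suc k \<le> col_height r (R # T)"
        using IH(4) Some p by auto
      ultimately show ?thesis using IH Some p
        by (intro exI[of _ "Suc k"] exI[of _ l] exI[of _ "u @ drop r R"] exI[of _ "u1 @ drop r B @ x # C"] exI[of _ y] exI[of _ v])
          simp
    qed
  qed
qed

lemma tail_depth_row_insert_left:
  assumes "tableau T" "r \<le> new_cell_col x T" "x < b"
  shows "tail_depth b r (row_insert x T) = tail_depth b r T"
proof -
  have "\<forall>R\<in>set (map (drop r) T). sorted R" using tableau_sorted[OF assms(1)] by (auto simp: sorted_wrt_drop)
  then have "knuth (tail_word r T @ [x]) (tail_word r (row_insert x T))"
    unfolding tail_word_def map_drop_row_insert[OF assms(1,2)] by (rule knuth_row_insert)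
  then show ?thesis unfolding tail_depth_def using depth_knuth depth_snoc_small assms(3) by metis
qed

text \<open>The bumping path has as many letters as the new column \<open>s\<close> has cells, and
  all of them are at least \<open>x\<close>.\<close>

lemma tail_depth_row_insert_big:
  assumes "tableau T" "s = new_cell_col x T" "b \<le> x"
  shows "tail_depth b s (row_insert x T) = col_height s (row_insert x T)"
proof (rule antisym)
  show "tail_depth b s (row_insert x T) \<le> col_height s (row_insert x T)"
    by (intro tail_depth_le_col_height tableau_row_insert assms)
  obtain v where v: "length v = Suc (new_cell_row x T)" "sorted_wrt (>) v" "last v = x"
    "subseq v (tail_word s (row_insert x T))"
    using bump_path[OF assms(1,2)] by blast
  have "v \<noteq> []" using v(1) by auto
  then have "\<forall>y\<in>set v. x \<le> y" using v(2) unfolding v(3)[symmetric] by (rule last_le_of_decreasing)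
  then have "v \<in> dec_above b (tail_word s (row_insert x T))"
    using v assms(3) by (fastforce simp: dec_above_iff)
  then have "Suc (new_cell_row x T) \<le> tail_depth b s (row_insert x T)"
    unfolding tail_depth_def using length_le_depth v(1) by metis
  moreover have "col_height s (row_insert x T) = Suc (new_cell_row x T)"
    using col_height_row_insert col_height_new_cell_col assms by simp
  ultimately show "col_height s (row_insert x T) \<le> tail_depth b s (row_insert x T)" by simp
qed

text \<open>By Knuth invariance the old depth is that of \<open>l @ y # u1\<close>, while the new
  word is \<open>l @ u1\<close>. If a longest subword avoids \<open>y\<close>, nothing is lost;
  otherwise \<open>y\<close> is traded for the path \<open>v\<close> in the columns from
  \<open>s\<close> on.\<close>

lemma tail_depth_row_insert_right:
  assumes "tableau T" "s = new_cell_col x T" "s < r" "x < b"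
  shows "tail_depth b r (row_insert x T) \<le> tail_depth b r T"
    "tail_depth b r T \<le> tail_depth b r (row_insert x T) \<or>
     tail_depth b r T + col_height s T \<le> tail_depth b s T + col_height r T"
proof -
  obtain k l u u1 y v where u: "tail_word r T = l @ u" "tail_word r (row_insert x T) = l @ u1"
     "knuth (u @ [x]) (y # u1)" "\<forall>b. \<forall>c\<in>dec_above b l. length c + k \<le> col_height r T"
     "length v + k = Suc (new_cell_row x T)" "sorted_wrt (>) v" "v \<noteq> []" "last v = y"
     "subseq (v @ u1) (tail_word s (row_insert x T))"
    using tail_word_insert_right[OF assms(1-3)] by blast
  have "depth b (l @ u) = depth b (l @ u @ [x])" using depth_snoc_small[OF assms(4), of "l @ u"] by simp
  also have "\<dots> = depth b (l @ y # u1)" by (intro depth_knuth knuth_append_left u(3))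
  finally have d: "tail_depth b r T = depth b (l @ y # u1)" by (simp add: tail_depth_def u(1))
  have d1: "tail_depth b r (row_insert x T) = depth b (l @ u1)" by (simp add: tail_depth_def u(2))
  have "subseq (l @ u1) (l @ y # u1)" by (auto simp: subseq_append' intro: list_emb_Cons)
  then show "tail_depth b r (row_insert x T) \<le> tail_depth b r T"
    unfolding d d1 by (rule depth_mono)
  obtain w where w: "w \<in> dec_above b (l @ [y] @ u1)" "length w = tail_depth b r T"
    using depth_obtain[of b "l @ [y] @ u1"] d by auto
  obtain w1 w23 where w1: "w = w1 @ w23" "w1 \<in> dec_above b l" "w23 \<in> dec_above b ([y] @ u1)"
      "\<forall>x\<in>set w1. \<forall>y\<in>set w23. y < x"
    using w(1) unfolding dec_above_append[of w] by blast
  obtain w2 w3 where w2: "w23 = w2 @ w3" "w2 \<in> dec_above b [y]" "w3 \<in> dec_above b u1"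
      "\<forall>x\<in>set w2. \<forall>y\<in>set w3. y < x"
    using w1(3) unfolding dec_above_append[of w23] by blast
  have "w2 = [] \<or> w2 = [y]" by (rule dec_above_row[OF _ w2(2)]) auto
  then show "tail_depth b r T \<le> tail_depth b r (row_insert x T) \<or>
     tail_depth b r T + col_height s T \<le> tail_depth b s T + col_height r T"
  proof
    assume "w2 = []"
    then have "w1 @ w3 \<in> dec_above b (l @ u1)"
      using w1 w2 by (intro dec_above_appendI) auto
    then show ?thesis using length_le_depth d1 w(2) w1(1) w2(1) \<open>w2 = []\<close> by fastforce
  next
    \<comment> \<open>Replacing \<open>w1\<close> and \<open>y\<close> by \<open>v\<close> gives a
      subword in the columns from \<open>s\<close> on. The bound follows from
      \<open>length w1 + k \<le> col_height r T\<close> and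
      \<open>length v + k = Suc (col_height s T)\<close>.\<close>
    assume y: "w2 = [y]"
    have "b \<le> y" using w2(2) y by (simp add: dec_above_iff)
    then have "v \<in> dec_above b v"
      using last_le_of_decreasing[OF u(7,6)] u(6,8) by (fastforce simp: dec_above_iff)
    moreover have "\<forall>p\<in>set v. \<forall>q\<in>set w3. q < p"
      using last_le_of_decreasing[OF u(7,6)] w2(4) y u(8) by fastforce
    ultimately have "v @ w3 \<in> dec_above b (v @ u1)" using w2(3) by (intro dec_above_appendI)
    then have "v @ w3 \<in> dec_above b (tail_word s (row_insert x T))" using dec_above_mono[OF u(9)] by blast
    then have "length v + length w3 \<le> tail_depth b s (row_insert x T)"
      unfolding tail_depth_def using length_le_depth by fastforce
    also have "\<dots> = tail_depth b s T" using tail_depth_row_insert_left[of T s x b] assms by simp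
    finally have "length v + length w3 \<le> tail_depth b s T" .
    moreover have "length w1 + k \<le> col_height r T" using u(4) w1(2) by blast
    moreover have "tail_depth b r T = length w1 + Suc (length w3)" using w(2) w1(1) w2(1) y by simp
    moreover have "col_height s T = new_cell_row x T" using col_height_new_cell_col assms by simp
    ultimately show ?thesis using u(5) by linarith
  qed
qed

subsection \<open>Symmetries of RSK\<close>

lemma row_insert_max: "\<forall>R\<in>set T. \<forall>x\<in>set R. x \<le> m \<Longrightarrow> row_insert m T = add_to_row 0 m T"
  by (cases T) (auto simp: add_to_row_def row_bump_None)

lemma new_cell_row_max: "\<forall>R\<in>set T. \<forall>x\<in>set R. x \<le> m \<Longrightarrow> new_cell_row m T = 0"
  by (cases T) (auto simp: row_bump_None)

lemma add_to_row_0_Cons [simp]: "add_to_row 0 m (R # T) = (R @ [m]) # T"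
  by (simp add: add_to_row_def)

lemma add_to_row_Suc_Cons [simp]: "add_to_row (Suc k) m (R # T) = R # add_to_row k m T"
  by (simp add: add_to_row_def)

text \<open>The \<open>m\<close> at the end of row \<open>c\<close> is disturbed only if the new
  cell falls on its place. Then it is bumped and, being maximal, comes to rest at the end of the
  next row.\<close>

lemma row_insert_add_to_row:
  assumes "y < m" "c \<le> length T" "\<forall>R\<in>set T. \<forall>x\<in>set R. x \<le> m" "\<forall>R\<in>set (take c T). \<forall>x\<in>set R. x < m"
  shows "row_insert y (add_to_row c m T) =
      add_to_row (if new_cell_row y T = c then Suc c else c) m (row_insert y T)"
    "new_cell_row y (add_to_row c m T) =
      (if new_cell_row y T = c then Suc (new_cell_row y T) else new_cell_row y T)"
proof -
  have "row_insert y (add_to_row c m T) =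
      add_to_row (if new_cell_row y T = c then Suc c else c) m (row_insert y T) \<and>
      new_cell_row y (add_to_row c m T) =
      (if new_cell_row y T = c then Suc (new_cell_row y T) else new_cell_row y T)"
    using assms
  proof (induction T arbitrary: y c)
    case Nil
    then show ?case by (simp add: add_to_row_def)
  next
    case (Cons R T)
    show ?case
    proof (cases c)
      case 0
      show ?thesis
      proof (cases rule: row_bump_cases[of R y])
        case None
        then have "row_bump y (R @ [m]) = (R @ [y], Some m)"
          using Cons.prems(1) row_bump_Some[of R y m "[]"] by simp
        then show ?thesis using None 0 Cons.prems by (simp add: row_insert_max new_cell_row_max)
      next
        case (Some B z C)
        then have "row_bump y (R @ [m]) = (B @ y # C @ [m], Some z)"
          using row_bump_Some[of B y z "C @ [m]"] by simp
        then show ?thesis using Some 0 by simp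
      qed
    next
      case (Suc c')
      show ?thesis
      proof (cases rule: row_bump_cases[of R y])
        case None
        then show ?thesis using Suc by simp
      next
        case (Some B z C)
        have "z < m" using Cons.prems(4) Some Suc by simp
        then show ?thesis using Cons.IH[of z c'] Cons.prems Some Suc by auto
      qed
    qed
  qed
  then show "row_insert y (add_to_row c m T) =
      add_to_row (if new_cell_row y T = c then Suc c else c) m (row_insert y T)"
    "new_cell_row y (add_to_row c m T) =
      (if new_cell_row y T = c then Suc (new_cell_row y T) else new_cell_row y T)" by auto
qed

lemma take_row_insert_less:
  assumes "y < m" "\<forall>R\<in>set (take c T). \<forall>x\<in>set R. x < m"
  shows "\<forall>R\<in>set (take (if new_cell_row y T = c then Suc c else c) (row_insert y T)). \<forall>x\<in>set R. x < m"
  using assms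
proof (induction T arbitrary: y c)
  case (Cons R T)
  show ?case
  proof (cases c)
    case 0
    show ?thesis
    proof (cases rule: row_bump_cases[of R y])
      case None
      then show ?thesis using 0 Cons.prems(1) by (auto intro: le_less_trans)
    next
      case (Some B z C)
      then show ?thesis using 0 by simp
    qed
  next
    case (Suc c')
    show ?thesis
    proof (cases rule: row_bump_cases[of R y])
      case None
      then show ?thesis using Suc Cons.prems by auto
    next
      case (Some B z C)
      have "z < m" using Cons.prems(2) Some Suc by simp
      then show ?thesis using Cons.IH[of z c'] Cons.prems Some Suc by auto
    qed
  qed
qed (simp add: take_Cons')

text \<open>In each row the second letter acts to the right of the first and, if it bumps at all,
  bumps a letter \<open>z' \<ge> z\<close>. So its path ends no lower.\<close>

lemma new_cell_row_antimono:
  "\<forall>R\<in>set T. sorted R \<Longrightarrow> j \<le> j' \<Longrightarrow> new_cell_row j' (row_insert j T) \<le> new_cell_row j T"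
proof (induction T arbitrary: j j')
  case (Cons R T)
  show ?case
  proof (cases rule: row_bump_cases[of R j])
    case None
    then have "row_bump j' (R @ [j]) = (R @ [j] @ [j'], None)"
      using Cons.prems row_bump_None[of "R @ [j]" j'] by (auto intro: order_trans)
    then show ?thesis using None by simp
  next
    case (Some B z C)
    have *: "row_bump j' (B @ j # C) = (case row_bump j' C of (S', b) \<Rightarrow> ((B @ [j]) @ S', b))"
      using Some Cons.prems row_bump_append[of "B @ [j]" j' C] by (fastforce intro: order_trans)
    note outer = Some
    show ?thesis
    proof (cases rule: row_bump_cases[of C j'])
      case None
      then show ?thesis using * outer by simp
    next
      case (Some B' z' C')
      then have "z \<le> z'" using Cons.prems(1) outer(1) by (simp add: sorted_append)
      then have "new_cell_row z' (row_insert z T) \<le> new_cell_row z T" using Cons by simp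
      then show ?thesis using * outer Some by simp
    qed
  qed
qed simp

section \<open>RSK on lists of biletters and its symmetry\<close>

abbreviation rsk_fold :: "(nat \<times> nat) list \<Rightarrow> nat list list \<times> nat list list" where
  "rsk_fold B \<equiv> fold rsk_step B ([], [])"

lemma rsk_fold_snoc:
  "rsk_fold (B @ [(i, j)]) =
     (row_insert j (fst (rsk_fold B)), add_to_row (new_cell_row j (fst (rsk_fold B))) i (snd (rsk_fold B)))"
  by (simp add: rsk_step_def split: prod.splits)

lemma fst_rsk_fold: "fst (rsk_fold B) = insertion_tableau (map snd B)"
  by (induction B rule: rev_induct) (auto simp: rsk_step_def insertion_tableau_def split: prod.splits)

lemma tableau_fst_rsk_fold: "tableau (fst (rsk_fold B))"
  by (simp add: fst_rsk_fold tableau_insertion_tableau)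

lemma map_length_add_to_row_cong:
  "map length T = map length U \<Longrightarrow> map length (add_to_row k i T) = map length (add_to_row k j U)"
proof -
  assume l: "map length T = map length U"
  then have len: "length T = length U" by (metis length_map)
  moreover have "length (T ! k) = length (U ! k)" if "k < length T" using l len that by (metis nth_map)
  ultimately show ?thesis using l by (simp add: add_to_row_def map_update)
qed

lemma shape_rsk_fold: "map length (snd (rsk_fold B)) = map length (fst (rsk_fold B))"
proof (induction B rule: rev_induct)
  case (snoc x B)
  obtain i j where x: "x = (i, j)" by fastforce
  show ?case unfolding x rsk_fold_snoc fst_conv snd_conv
    using map_length_add_to_row_cong[OF snoc] shape_row_insert[of j "fst (rsk_fold B)" i] by simp
qed simp

lemma length_rsk_fold: "length (snd (rsk_fold B)) = length (fst (rsk_fold B))"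
  using shape_rsk_fold by (metis length_map)

lemma set_add_to_row: "\<Union> (set ` set (add_to_row k i T)) \<subseteq> insert i (\<Union> (set ` set T))"
proof (cases "k < length T")
  case True
  have "set (T[k := T ! k @ [i]]) \<subseteq> insert (T ! k @ [i]) (set T)" by (rule set_update_subset_insert)
  moreover have "set (T ! k) \<subseteq> \<Union> (set ` set T)" using True nth_mem by blast
  ultimately show ?thesis using True unfolding add_to_row_def by fastforce
qed (simp add: add_to_row_def)

lemma set_snd_rsk_fold: "\<Union> (set ` set (snd (rsk_fold B))) \<subseteq> fst ` set B"
proof (induction B rule: rev_induct)
  case (snoc x B)
  obtain i j where x: "x = (i, j)" by fastforce
  show ?case unfolding x rsk_fold_snoc snd_conv
    by (rule subset_trans[OF set_add_to_row[of "new_cell_row j (fst (rsk_fold B))" i "snd (rsk_fold B)"]]) (use snoc in auto)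
qed simp

lemma set_fst_rsk_fold: "\<Union> (set ` set (fst (rsk_fold B))) \<subseteq> snd ` set B"
proof (induction B rule: rev_induct)
  case (snoc x B)
  obtain i j where x: "x = (i, j)" by fastforce
  show ?case unfolding x rsk_fold_snoc fst_conv
    by (rule subset_trans[OF set_row_insert[of j "fst (rsk_fold B)"]]) (use snoc in auto)
qed simp

lemma labels_le:
  assumes "\<forall>q\<in>set B. fst q \<le> i" shows "\<forall>R\<in>set (snd (rsk_fold B)). \<forall>x\<in>set R. x \<le> i"
proof (intro ballI)
  fix R x assume "R \<in> set (snd (rsk_fold B))" "x \<in> set R"
  then have "x \<in> fst ` set B" by (intro subsetD[OF set_snd_rsk_fold]) blast
  then show "x \<le> i" using assms by blast
qed

lemma letters_le:
  assumes "\<forall>q\<in>set B. snd q \<le> j" shows "\<forall>R\<in>set (fst (rsk_fold B)). \<forall>x\<in>set R. x \<le> j"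
proof (intro ballI)
  fix R x assume "R \<in> set (fst (rsk_fold B))" "x \<in> set R"
  then have "x \<in> snd ` set B" by (intro subsetD[OF set_fst_rsk_fold]) blast
  then show "x \<le> j" using assms by blast
qed

lemma take_add_to_row: "c \<le> k \<Longrightarrow> k \<le> length T \<Longrightarrow> take c (add_to_row k i T) = take c T"
  by (simp add: add_to_row_def)

text \<open>Equal labels are recorded from bottom left to top right.\<close>

lemma labels_above_new_cell:
  "sorted (B @ [(i, j)]) \<Longrightarrow>
     \<forall>R\<in>set (take (new_cell_row j (fst (rsk_fold B))) (snd (rsk_fold B))). \<forall>x\<in>set R. x < i"
proof (induction B arbitrary: i j rule: rev_induct)
  case (snoc p B)
  obtain i0 j0 where p: "p = (i0, j0)" by fastforce
  define k where "k = new_cell_row j (fst (rsk_fold (B @ [p])))"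
  define k0 where "k0 = new_cell_row j0 (fst (rsk_fold B))"
  have le: "(i0, j0) \<le> (i, j)" "\<forall>q\<in>set B. q \<le> (i0, j0)"
    using snoc.prems p by (auto simp: sorted_append)
  show ?case
  proof (cases "i0 < i")
    case True
    have "\<forall>q\<in>set (B @ [p]). fst q \<le> i0"
      using le(2) p by (auto simp: less_eq_prod_def)
    from labels_le[OF this] show ?thesis using True by (auto dest!: in_set_takeD intro: le_less_trans)
  next
    case False
    then have eq: "i0 = i" "j0 \<le> j" using le(1) by auto
    \<comment> \<open>Equal labels carry weakly increasing letters, so the new cell is weakly above
      the previous one, and the previous step left the \<open>k\<close> rows above it
      untouched.\<close>
    have "k \<le> k0" unfolding k_def k0_def p rsk_fold_snoc fst_conv
      using new_cell_row_antimono[OF tableau_sorted[OF tableau_fst_rsk_fold] eq(2)] .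
    moreover have "k0 \<le> length (snd (rsk_fold B))"
      unfolding k0_def length_rsk_fold by (rule new_cell_row_le)
    ultimately have "take k (snd (rsk_fold (B @ [p]))) = take k (snd (rsk_fold B))"
      unfolding p rsk_fold_snoc snd_conv k0_def[symmetric] by (rule take_add_to_row)
    moreover have "\<forall>R\<in>set (take k0 (snd (rsk_fold B))). \<forall>x\<in>set R. x < i0"
      unfolding k0_def using snoc.prems p by (intro snoc.IH) (simp add: sorted_append)
    moreover have "set (take k (snd (rsk_fold B))) \<subseteq> set (take k0 (snd (rsk_fold B)))"
      using \<open>k \<le> k0\<close> by (rule set_take_subset_set_take)
    ultimately show ?thesis using eq unfolding k_def by auto
  qed
qed simp

text \<open>
  The hypotheses say that \<open>(m, p)\<close> is the last biletter of the transposed biword, hence is inserted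
  last when RSK is applied to the transposed matrix.
\<close>

lemma rsk_fold_insert_max:
  assumes "sorted (u @ v)"
    and "\<forall>q\<in>set u. fst q \<le> p \<and> snd q \<le> m" "\<forall>q\<in>set v. p < fst q \<and> snd q < m"
  shows "\<exists>c. c = new_cell_row p (snd (rsk_fold (u @ v))) \<and>
    rsk_fold (u @ (p, m) # v) = (add_to_row c m (fst (rsk_fold (u @ v))), row_insert p (snd (rsk_fold (u @ v)))) \<and>
    (\<forall>R\<in>set (take c (fst (rsk_fold (u @ v)))). \<forall>x\<in>set R. x < m)"
  using assms
proof (induction v rule: rev_induct)
  case Nil
  have "\<forall>R\<in>set (fst (rsk_fold u)). \<forall>x\<in>set R. x \<le> m" "\<forall>R\<in>set (snd (rsk_fold u)). \<forall>x\<in>set R. x \<le> p"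
    using Nil.prems(2) by (intro letters_le labels_le; simp)+
  then show ?case
    using rsk_fold_snoc[of u p m] by (simp add: row_insert_max new_cell_row_max)
next
  case (snoc q v)
  obtain t y where q: "q = (t, y)" by fastforce
  let ?P = "fst (rsk_fold (u @ v))" and ?Q = "snd (rsk_fold (u @ v))"
  define c where "c = new_cell_row p ?Q"
  define d where "d = new_cell_row y ?P"
  have IH: "rsk_fold (u @ (p, m) # v) = (add_to_row c m ?P, row_insert p ?Q)"
    "\<forall>R\<in>set (take c ?P). \<forall>x\<in>set R. x < m"
    using snoc.IH snoc.prems unfolding c_def by (simp_all add: sorted_append)
  have ty: "y < m" "p < t" using snoc.prems(3) q by auto
  have Pm: "\<forall>R\<in>set ?P. \<forall>x\<in>set R. x \<le> m"
    using snoc.prems(2,3) by (intro letters_le) (auto intro: less_imp_le)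
  have "\<forall>q'\<in>set (u @ v). q' \<le> (t, y)"
    using snoc.prems(1) unfolding q by (auto simp: sorted_append)
  then have "\<forall>q'\<in>set (u @ v). fst q' \<le> t"
    by (fastforce simp: less_eq_prod_def)
  then have Qt: "\<forall>R\<in>set ?Q. \<forall>x\<in>set R. x \<le> t" by (rule labels_le)
  have Qd: "\<forall>R\<in>set (take d ?Q). \<forall>x\<in>set R. x < t"
    unfolding d_def using snoc.prems(1) by (intro labels_above_new_cell) (simp add: q)
  have len: "c \<le> length ?P" "d \<le> length ?Q"
    unfolding c_def d_def using new_cell_row_le length_rsk_fold by metis+
  have uv: "rsk_fold (u @ v @ [q]) = (row_insert y ?P, add_to_row d t ?Q)"
    using rsk_fold_snoc[of "u @ v" t y] by (simp add: q d_def)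
  have "rsk_fold (u @ (p, m) # v @ [q]) =
    (row_insert y (add_to_row c m ?P), add_to_row (new_cell_row y (add_to_row c m ?P)) t (row_insert p ?Q))"
    using rsk_fold_snoc[of "u @ (p, m) # v" t y] IH(1) by (simp add: q)
  also have "row_insert y (add_to_row c m ?P) = add_to_row (if d = c then Suc c else c) m (row_insert y ?P)"
    unfolding d_def using ty len IH Pm by (intro row_insert_add_to_row)
  also have "new_cell_row y (add_to_row c m ?P) = (if d = c then Suc d else d)"
    unfolding d_def using ty len IH Pm by (intro row_insert_add_to_row)
  \<comment> \<open>The same commutation on the recording side, where \<open>t\<close> takes the
    role of the maximal letter. In both tableaux the case distinction is whether the two new cells
    lie in the same row.\<close>
  also have "add_to_row (if d = c then Suc d else d) t (row_insert p ?Q) = row_insert p (add_to_row d t ?Q)"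
    using row_insert_add_to_row(1)[OF ty(2) len(2) Qt Qd] unfolding c_def[symmetric] by auto
  finally have 1: "rsk_fold (u @ (p, m) # v @ [q]) =
    (add_to_row (if d = c then Suc c else c) m (row_insert y ?P), row_insert p (add_to_row d t ?Q))" .
  have 2: "new_cell_row p (add_to_row d t ?Q) = (if d = c then Suc c else c)"
    using row_insert_add_to_row(2)[OF ty(2) len(2) Qt Qd] unfolding c_def[symmetric] by auto
  have 3: "\<forall>R\<in>set (take (if d = c then Suc c else c) (row_insert y ?P)). \<forall>x\<in>set R. x < m"
    unfolding d_def using ty(1) IH(2) by (rule take_row_insert_less)
  show ?case using 1 2 3 uv by simp
qed

text \<open>Induction on the length, removing the biletter that comes last after swapping. It is
  inserted last on the swapped side, and \<open>rsk_fold_insert_max\<close> describes its effect in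
  the middle of the original list.\<close>

theorem rsk_fold_swap:
  "sorted B \<Longrightarrow> rsk_fold (sort (map prod.swap B)) = prod.swap (rsk_fold B)"
proof (induction "length B" arbitrary: B)
  case 0
  then show ?case by simp
next
  case (Suc n)
  let ?B' = "sort (map prod.swap B)"
  have "?B' \<noteq> []" using Suc.hyps(2) by (metis length_0_conv length_map length_sort nat.distinct(1))
  then obtain m p C where C: "?B' = C @ [(m, p)]" by (metis rev_exhaust surj_pair)
  have max: "prod.swap q \<le> (m, p)" if "q \<in> set B" for q
  proof -
    have "prod.swap q \<in> set ?B'" using that by auto
    moreover have "sorted ?B'" by simp
    ultimately show ?thesis unfolding C by (auto simp: sorted_append)
  qed
  have "(m, p) \<in> set ?B'" unfolding C by simp
  then have "(p, m) \<in> set B" by auto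
  \<comment> \<open>The last occurrence is taken, so that every later biletter is strictly larger in
    the first coordinate and strictly smaller in the second.\<close>
  then obtain u v where uv: "B = u @ (p, m) # v" "(p, m) \<notin> set v" by (meson split_list_last)
  have s: "sorted (u @ v)" using Suc.prems unfolding uv by (auto simp: sorted_append)
  have u: "\<forall>q\<in>set u. fst q \<le> p \<and> snd q \<le> m"
  proof
    fix q assume "q \<in> set u"
    then have "q \<le> (p, m)" "prod.swap q \<le> (m, p)" using Suc.prems max unfolding uv by (auto simp: sorted_append)
    then show "fst q \<le> p \<and> snd q \<le> m" by (cases q) auto
  qed
  have v: "\<forall>q\<in>set v. p < fst q \<and> snd q < m"
  proof
    fix q assume "q \<in> set v"
    then have "(p, m) \<le> q" "prod.swap q \<le> (m, p)" "q \<noteq> (p, m)"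
      using Suc.prems max uv by (auto simp: sorted_append)
    then show "p < fst q \<and> snd q < m" by (cases q) auto
  qed
  have "sort (map prod.swap (u @ v)) = C"
  proof (rule properties_for_sort)
    have "mset ?B' = mset (map prod.swap B)" by simp
    then show "mset C = mset (map prod.swap (u @ v))" unfolding C by (simp add: uv)
    have "sorted ?B'" by simp
    then show "sorted C" unfolding C by (simp add: sorted_append)
  qed
  then have IH: "rsk_fold C = prod.swap (rsk_fold (u @ v))"
    using Suc.hyps(1)[of "u @ v"] Suc.hyps(2) s uv by simp
  show ?case
    using rsk_fold_insert_max[OF s u v] unfolding C rsk_fold_snoc IH by (simp add: uv)
qed

lemma snd_rsk_fold: "sorted B \<Longrightarrow> snd (rsk_fold B) = fst (rsk_fold (sort (map prod.swap B)))"
  by (simp add: rsk_fold_swap)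

text \<open>By symmetry the recording tableau is itself an insertion tableau.\<close>

lemma tableau_snd_rsk_fold: "sorted B \<Longrightarrow> tableau (snd (rsk_fold B))"
  by (simp only: snd_rsk_fold tableau_fst_rsk_fold)

subsection \<open>Biwords\<close>

lemma RSK_eq: "RSK n m A = rsk_fold (biword n m A)"
  by (simp add: RSK_def)

definition biword_row :: "nat \<Rightarrow> (nat \<Rightarrow> nat \<Rightarrow> nat) \<Rightarrow> nat \<Rightarrow> (nat \<times> nat) list" where
  "biword_row m A i = concat (map (\<lambda>j. replicate (A i j) (i, j)) [1..<Suc m])"

lemma biword_eq: "biword n m A = concat (map (biword_row m A) [1..<Suc n])"
  by (simp add: biword_def biword_row_def[abs_def])

lemma set_biword_row: "set (biword_row m A i) = {i} \<times> {j \<in> {1..m}. A i j \<noteq> 0}"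
  by (auto simp: biword_row_def simp del: upt_Suc)

lemma set_biword: "set (biword n m A) = supp n m A"
  by (auto simp: biword_eq set_biword_row supp_def simp del: upt_Suc)

lemma biword_row_Suc: "biword_row (Suc m) A i = biword_row m A i @ replicate (A i (Suc m)) (i, Suc m)"
  by (simp add: biword_row_def)

lemma biword_Suc: "biword (Suc n) m A = biword n m A @ biword_row m A (Suc n)"
  by (simp add: biword_eq)

lemma sorted_biword_row: "sorted (biword_row m A i)"
proof (induction m)
  case (Suc m)
  then show ?case by (auto simp: biword_row_Suc sorted_append set_biword_row)
qed (simp add: biword_row_def)

lemma sorted_biword: "sorted (biword n m A)"
proof (induction n)
  case (Suc n)
  then show ?case
    by (auto simp: biword_Suc sorted_append sorted_biword_row set_biword_row set_biword supp_def)
qed (simp add: biword_def)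

lemma count_biword_row:
  "count (mset (biword_row m A i)) (i', j) = (if i' = i \<and> j \<in> {1..m} then A i j else 0)"
proof (induction m)
  case (Suc m)
  then show ?case by (auto simp: biword_row_Suc)
qed (simp add: biword_row_def)

lemma count_biword:
  "count (mset (biword n m A)) (i, j) = (if i \<in> {1..n} \<and> j \<in> {1..m} then A i j else 0)"
proof (induction n)
  case (Suc n)
  then show ?case by (auto simp: biword_Suc count_biword_row)
qed (simp add: biword_def)

text \<open>Both sides are sorted and contain each biletter equally often.\<close>

lemma biword_transpose: "biword m n (\<lambda>i j. A j i) = sort (map prod.swap (biword n m A))"
proof (rule sym, rule properties_for_sort)
  have "count (mset (map prod.swap B)) (i, j) = count (mset B) (j, i)" for B and i j :: nat
    by (induction B) auto
  then show "mset (biword m n (\<lambda>i j. A j i)) = mset (map prod.swap (biword n m A))"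
    by (intro multiset_eqI) (auto simp: count_biword simp del: mset_map)
qed (rule sorted_biword)

lemma RSK_transpose: "RSK m n (\<lambda>i j. A j i) = prod.swap (RSK n m A)"
  unfolding RSK_eq by (subst biword_transpose) (rule rsk_fold_swap[OF sorted_biword])

section \<open>Rotation of the matrix and evacuation\<close>

definition rotate_matrix :: "nat \<Rightarrow> nat \<Rightarrow> (nat \<Rightarrow> nat \<Rightarrow> nat) \<Rightarrow> nat \<Rightarrow> nat \<Rightarrow> nat" where
  "rotate_matrix n m A = (\<lambda>i j. A (n + 1 - i) (m + 1 - j))"

lemma upt_reflect: "[1..<Suc n] = map (\<lambda>i. n + 1 - i) (rev [1..<Suc n])"
  by (intro nth_equalityI) (auto simp: rev_nth simp del: upt_Suc)

lemma biword_rotate: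
  "biword n m (rotate_matrix n m A) = rev (map (\<lambda>(i, j). (n + 1 - i, m + 1 - j)) (biword n m A))"
proof -
  have row: "biword_row m (rotate_matrix n m A) (n + 1 - i) =
      rev (map (\<lambda>(i, j). (n + 1 - i, m + 1 - j)) (biword_row m A i))" if "i \<in> {1..n}" for i
  proof -
    have "biword_row m (rotate_matrix n m A) (n + 1 - i) =
      concat (map (\<lambda>j. replicate (A (n + 1 - (n + 1 - i)) (m + 1 - j)) (n + 1 - i, j))
        (map (\<lambda>j. m + 1 - j) (rev [1..<Suc m])))"
      unfolding biword_row_def rotate_matrix_def by (subst upt_reflect) (rule refl)
    also have "\<dots> = concat (map (\<lambda>j. replicate (A i j) (n + 1 - i, m + 1 - j)) (rev [1..<Suc m]))"
      unfolding map_map comp_def using that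
      by (intro arg_cong[where f = concat] map_cong) (auto simp del: upt_Suc)
    also have "\<dots> = rev (map (\<lambda>(i, j). (n + 1 - i, m + 1 - j)) (biword_row m A i))"
      by (simp add: biword_row_def map_concat rev_concat rev_map comp_def del: upt_Suc)
    finally show ?thesis .
  qed
  have "biword n m (rotate_matrix n m A) =
      concat (map (biword_row m (rotate_matrix n m A)) (map (\<lambda>i. n + 1 - i) (rev [1..<Suc n])))"
    unfolding biword_eq by (subst upt_reflect) (rule refl)
  also have "\<dots> = concat (map (\<lambda>i. rev (map (\<lambda>(i, j). (n + 1 - i, m + 1 - j)) (biword_row m A i))) (rev [1..<Suc n]))"
    unfolding map_map comp_def using row
    by (intro arg_cong[where f = concat] map_cong) (auto simp del: upt_Suc)
  also have "\<dots> = rev (map (\<lambda>(i, j). (n + 1 - i, m + 1 - j)) (biword n m A))"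
    by (simp add: biword_eq map_concat rev_concat rev_map comp_def del: upt_Suc)
  finally show ?thesis .
qed

lemma fst_RSK: "fst (RSK n m A) = insertion_tableau (map snd (biword n m A))"
  by (simp add: RSK_eq fst_rsk_fold)

lemma fst_RSK_rotate: "fst (RSK n m (rotate_matrix n m A)) = ev m (fst (RSK n m A))"
proof -
  have "set (map snd (biword n m A)) \<subseteq> {1..m}" by (auto simp: set_biword supp_def)
  then have "ev m (fst (RSK n m A)) = insertion_tableau (rev_complement m (map snd (biword n m A)))"
    unfolding fst_RSK by (rule ev_insertion_tableau)
  also have "rev_complement m (map snd (biword n m A)) = map snd (biword n m (rotate_matrix n m A))"
    unfolding biword_rotate rev_complement_def by (simp add: rev_map comp_def case_prod_unfold)
  finally show ?thesis by (simp add: fst_RSK)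
qed

lemma RSK_rotate:
  assumes "RSK n m A = (P, Q)" shows "RSK n m (rotate_matrix n m A) = (ev m P, ev n Q)"
proof (rule prod_eqI)
  show "fst (RSK n m (rotate_matrix n m A)) = fst (ev m P, ev n Q)" using fst_RSK_rotate assms by simp
  \<comment> \<open>Rotation commutes with transposition, so the result on first tableaux, applied
    to the transposed matrix, gives the one on second tableaux.\<close>
  have "snd (RSK n m (rotate_matrix n m A)) = fst (RSK m n (rotate_matrix m n (\<lambda>i j. A j i)))"
    using RSK_transpose[of m n "rotate_matrix n m A"] by (simp add: rotate_matrix_def)
  also have "\<dots> = ev n (fst (RSK m n (\<lambda>i j. A j i)))" by (rule fst_RSK_rotate)
  also have "\<dots> = ev n Q" using RSK_transpose[of m n A] assms by simp
  finally show "snd (RSK n m (rotate_matrix n m A)) = snd (ev m P, ev n Q)" by simp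
qed

lemma supp_rotate:
  "(i, j) \<in> supp n m (rotate_matrix n m A) \<longleftrightarrow> i \<in> {1..n} \<and> j \<in> {1..m} \<and> (n + 1 - i, m + 1 - j) \<in> supp n m A"
  by (auto simp: supp_def rotate_matrix_def)

lemma RSK_Tab:
  assumes "RSK n m A = (P, Q)"
  shows "P \<in> Tab m" "Q \<in> Tab n" "shape P = shape Q"
proof -
  have s: "P = fst (rsk_fold (biword n m A))" "Q = snd (rsk_fold (biword n m A))" using assms by (simp_all add: RSK_eq)
  have "\<forall>R\<in>set P. set R \<subseteq> {1..m}"
    using set_fst_rsk_fold[of "biword n m A"] unfolding s set_biword by (fastforce simp: supp_def)
  then show "P \<in> Tab m" using tableau_fst_rsk_fold by (simp add: Tab_iff s)
  have "\<forall>R\<in>set Q. set R \<subseteq> {1..n}"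
    using set_snd_rsk_fold[of "biword n m A"] unfolding s set_biword by (fastforce simp: supp_def)
  then show "Q \<in> Tab n" using tableau_snd_rsk_fold sorted_biword by (simp add: Tab_iff s)
  show "shape P = shape Q" using shape_rsk_fold s by (simp add: shape_def)
qed

subsection \<open>Vanishing blocks\<close>

lemma depth_zero: "\<forall>x\<in>set u. x < b \<Longrightarrow> depth b u = 0"
proof -
  assume u: "\<forall>x\<in>set u. x < b"
  have "depth b u \<le> 0"
  proof (rule depth_leI)
    fix w assume w: "w \<in> dec_above b u"
    then have "\<forall>x\<in>set w. x < b \<and> b \<le> x" using u set_dec_above[OF w] by (auto simp: dec_above_iff)
    then show "length w \<le> 0" by (cases w) auto
  qed
  then show ?thesis by simp
qed

lemma set_tail_word: "set (tail_word r T) \<subseteq> \<Union> (set ` set T)"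
  by (auto simp: tail_word_def reading_word_def dest: in_set_dropD)

lemma tail_depth_zero: "\<forall>R\<in>set T. \<forall>x\<in>set R. x < b \<Longrightarrow> tail_depth b r T = 0"
  unfolding tail_depth_def using set_tail_word by (intro depth_zero) fastforce

lemma sorted_snoc_labels:
  "sorted (B @ [(i, j :: nat)]) \<Longrightarrow> \<forall>q\<in>set B. fst q \<le> (i :: nat)"
  by (fastforce simp: sorted_append less_eq_prod_def)

lemma new_cell_col_recording:
  "new_cell_col j (fst (rsk_fold B)) =
    (let k = new_cell_row j (fst (rsk_fold B)); Q = snd (rsk_fold B) in if k < length Q then length (Q ! k) else 0)"
  unfolding new_cell_col_def Let_def using shape_rsk_fold[of B] length_rsk_fold[of B] by (metis nth_map)

lemma tail_depth_recording_zero: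
  "\<forall>q\<in>set B. fst q < a \<Longrightarrow> tail_depth a r (snd (rsk_fold B)) = 0"
proof (rule tail_depth_zero, intro ballI)
  fix R x assume B: "\<forall>q\<in>set B. fst q < a" and "R \<in> set (snd (rsk_fold B))" "x \<in> set R"
  then have "x \<in> fst ` set B" by (intro subsetD[OF set_snd_rsk_fold]) blast
  then show "x < a" using B by blast
qed

lemma tail_depth_recording_snoc:
  assumes "sorted (B @ [(i, j)])" "a \<le> i"
  shows "tail_depth a r (snd (rsk_fold (B @ [(i, j)]))) =
    (let s = new_cell_col j (fst (rsk_fold B)); Q = snd (rsk_fold B) in
     if r \<le> s then max (tail_depth a r Q) (Suc (tail_depth a s Q)) else tail_depth a r Q)"
proof -
  have "sorted B" using assms(1) by (simp add: sorted_append)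
  moreover have "tableau (add_to_row (new_cell_row j (fst (rsk_fold B))) i (snd (rsk_fold B)))"
    using tableau_snd_rsk_fold[OF assms(1)] unfolding rsk_fold_snoc snd_conv .
  moreover have "new_cell_row j (fst (rsk_fold B)) \<le> length (snd (rsk_fold B))"
    unfolding length_rsk_fold by (rule new_cell_row_le)
  ultimately show ?thesis
    unfolding rsk_fold_snoc snd_conv Let_def
    using new_cell_col_recording[of j B] labels_le[OF sorted_snoc_labels[OF assms(1)]]
      labels_above_new_cell[OF assms(1)] assms(2)
    by (intro tail_depth_add_to_row tableau_snd_rsk_fold) (simp_all add: Let_def)
qed

text \<open>Both sides change alike along the biword: they hold while the labels are below
  \<open>a\<close>, a biletter in the block makes both fail, and any other biletter leaves both
  truth values unchanged.\<close>

lemma block_zero_iff: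
  assumes "sorted B"
  shows "(\<forall>r. tail_depth b r (fst (rsk_fold B)) + tail_depth a r (snd (rsk_fold B)) \<le> col_height r (fst (rsk_fold B))) \<longleftrightarrow>
    (\<forall>q\<in>set B. \<not> (a \<le> fst q \<and> b \<le> snd q))"
  using assms
proof (induction B rule: rev_induct)
  case Nil
  have "tail_depth b r [] = 0" "tail_depth a r [] = 0" for r by (simp_all add: tail_depth_zero)
  then show ?case by simp
next
  case (snoc q B)
  obtain i j where q: "q = (i, j)" by fastforce
  note sorted = snoc.prems[unfolded q]
  let ?P = "fst (rsk_fold B)" and ?Q = "snd (rsk_fold B)"
  let ?P' = "fst (rsk_fold (B @ [q]))" and ?Q' = "snd (rsk_fold (B @ [q]))"
  let ?f = "\<lambda>r. tail_depth b r ?P" and ?g = "\<lambda>r. tail_depth a r ?Q" and ?h = "\<lambda>r. col_height r ?P"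
  let ?f' = "\<lambda>r. tail_depth b r ?P'" and ?g' = "\<lambda>r. tail_depth a r ?Q'" and ?h' = "\<lambda>r. col_height r ?P'"
  define s where "s = new_cell_col j ?P"
  have P': "?P' = row_insert j ?P" unfolding q rsk_fold_snoc fst_conv ..
  have T: "tableau ?P" "tableau ?P'" by (rule tableau_fst_rsk_fold)+
  have IH: "(\<forall>r. ?f r + ?g r \<le> ?h r) \<longleftrightarrow> (\<forall>q\<in>set B. \<not> (a \<le> fst q \<and> b \<le> snd q))"
    using snoc by (simp add: sorted_append)
  have h': "?h' r = ?h r + (if r = s then 1 else 0)" for r
    unfolding P' s_def by (rule col_height_row_insert[OF T(1)])
  show ?case
  proof (cases "a \<le> i")
    case False
    \<comment> \<open>By sortedness no label so far reaches \<open>a\<close>, and the claim reduces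
      to \<open>tail_depth_le_col_height\<close>.\<close>
    then have lt: "\<forall>q\<in>set (B @ [q]). fst q < a"
      using sorted_snoc_labels[OF sorted] q by auto
    then have "?g' r = 0" for r by (rule tail_depth_recording_zero)
    moreover have "?f' r \<le> ?h' r" for r using T(2) by (rule tail_depth_le_col_height)
    ultimately show ?thesis using lt by (auto simp: not_le)
  next
    case True
    have g': "?g' r = (if r \<le> s then max (?g r) (Suc (?g s)) else ?g r)" for r
      unfolding q using tail_depth_recording_snoc[OF sorted True] by (simp add: s_def Let_def)
    show ?thesis
    proof (cases "b \<le> j")
      case True
      have "?f' s = ?h' s" unfolding P' s_def by (rule tail_depth_row_insert_big[OF T(1) refl True])
      moreover have "0 < ?g' s" using g'[of s] by simp
      ultimately have "\<not> (\<forall>r. ?f' r + ?g' r \<le> ?h' r)" by (metis add_le_same_cancel1 leD)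
      then show ?thesis using True \<open>a \<le> i\<close> q by auto
    next
      case False
      then have j: "j < b" by simp
      have fl: "?f' r = ?f r" if "r \<le> s" for r
        unfolding P' using that j by (intro tail_depth_row_insert_left T) (simp_all add: s_def)
      have fr: "?f' r \<le> ?f r" "?f r \<le> ?f' r \<or> ?f r + ?h s \<le> ?f s + ?h r" if "s < r" for r
        unfolding P' using tail_depth_row_insert_right[OF T(1) s_def that j] by simp_all
      have "(\<forall>r. ?f' r + ?g' r \<le> ?h' r) \<longleftrightarrow> (\<forall>r. ?f r + ?g r \<le> ?h r)"
      proof
        assume A: "\<forall>r. ?f r + ?g r \<le> ?h r"
        show "\<forall>r. ?f' r + ?g' r \<le> ?h' r"
        proof
          fix r
          consider "r < s" | "r = s" | "s < r" by linarith
          then show "?f' r + ?g' r \<le> ?h' r"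
          proof cases
            case 1
            \<comment> \<open>Left of \<open>s\<close> the value \<open>Suc (?g s)\<close> may
              decide the maximum. The comparison of columns \<open>r\<close> and \<open>s\<close> in
              the new tableau, where column \<open>s\<close> has grown, makes up for the extra
              1.\<close>
            have "?f' r + ?h' s \<le> ?f' s + ?h' r" using 1 T(2) by (intro tail_depth_col_height_mono) auto
            then have "?f r + Suc (?h s) \<le> ?f s + ?h r" using 1 fl[of r] fl[of s] h'[of r] h'[of s] by simp
            then show ?thesis using 1 A[rule_format, of r] A[rule_format, of s] fl[of r] g'[of r] h'[of r] by auto
          next
            case 2
            then show ?thesis using A[rule_format, of s] fl[of s] g'[of s] h'[of s] by simp
          next
            case 3
            then show ?thesis using A[rule_format, of r] fr(1)[of r] g'[of r] h'[of r] by simp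
          qed
        qed
      next
        assume A: "\<forall>r. ?f' r + ?g' r \<le> ?h' r"
        have As: "?f s + ?g s \<le> ?h s" using A[rule_format, of s] fl[of s] g'[of s] h'[of s] by simp
        show "\<forall>r. ?f r + ?g r \<le> ?h r"
        proof
          fix r
          consider "r < s" | "r = s" | "s < r" by linarith
          then show "?f r + ?g r \<le> ?h r"
          proof cases
            case 1
            then show ?thesis using A[rule_format, of r] fl[of r] g'[of r] h'[of r] by simp
          next
            case 2
            then show ?thesis using As by simp
          next
            case 3
            \<comment> \<open>If \<open>?f r\<close> has dropped, the second alternative of
              \<open>fr\<close>, the inequality in column \<open>s\<close> and this bound give the
              claim.\<close>
            have "?g r \<le> ?g s" using 3 by (intro tail_depth_antimono) simp
            then show ?thesis using 3 As A[rule_format, of r] fr(2)[of r] g'[of r] h'[of r] by auto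
          qed
        qed
      qed
      then show ?thesis using IH False q by auto
    qed
  qed
qed

text \<open>
  The column sets of the right key of a recording tableau are nested: \<open>y\<close> occurs exactly in the
  first \<open>d\<close> of them.
\<close>

lemma recording_tableau_nested:
  assumes "sorted B"
  shows "\<exists>d. \<forall>r. tail_depth y r (snd (rsk_fold B)) =
    tail_depth (Suc y) r (snd (rsk_fold B)) + (if r < d then 1 else 0)"
  using assms
proof (induction B rule: rev_induct)
  case Nil
  have "tail_depth b r [] = 0" for b r by (simp add: tail_depth_zero)
  then show ?case by auto
next
  case (snoc q B)
  obtain i j where q: "q = (i, j)" by fastforce
  note sorted = snoc.prems[unfolded q]
  let ?Q = "snd (rsk_fold B)" and ?Q' = "snd (rsk_fold (B @ [q]))"
  let ?f = "\<lambda>r. tail_depth y r ?Q" and ?g = "\<lambda>r. tail_depth (Suc y) r ?Q"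
  let ?f' = "\<lambda>r. tail_depth y r ?Q'" and ?g' = "\<lambda>r. tail_depth (Suc y) r ?Q'"
  define s where "s = new_cell_col j (fst (rsk_fold B))"
  obtain d where d: "\<And>r. ?f r = ?g r + (if r < d then 1 else 0)"
    using snoc by (auto simp: sorted_append)
  have f': "?f' r = (if r \<le> s then max (?f r) (Suc (?f s)) else ?f r)" if "y \<le> i" for r
    unfolding q using tail_depth_recording_snoc[OF sorted that] by (simp add: s_def Let_def)
  have g': "?g' r = (if r \<le> s then max (?g r) (Suc (?g s)) else ?g r)" if "Suc y \<le> i" for r
    unfolding q using tail_depth_recording_snoc[OF sorted that] by (simp add: s_def Let_def)
  have le: "\<forall>p\<in>set (B @ [q]). fst p \<le> i" using sorted_snoc_labels[OF sorted] q by auto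
  consider "i < y" | "i = y" | "y < i" by linarith
  then show ?case
  proof cases
    case 1
    then have "\<forall>p\<in>set (B @ [q]). fst p < y" "\<forall>p\<in>set (B @ [q]). fst p < Suc y" using le by fastforce+
    then have "?f' r = 0" "?g' r = 0" for r by (blast intro: tail_depth_recording_zero)+
    then show ?thesis by (intro exI[of _ 0]) simp
  next
    case 2
    then have "\<forall>p\<in>set (B @ [q]). fst p < Suc y" "\<forall>p\<in>set B. fst p < Suc y" using le by fastforce+
    then have 0: "?g' r = 0" "?g r = 0" for r by (blast intro: tail_depth_recording_zero)+
    \<comment> \<open>The rows from \<open>k\<close> on do not reach column \<open>s\<close>, and
      the labels above the new cell are less than \<open>i = y\<close>.\<close>
    have "?f s = 0"
    proof -
      define k where "k = new_cell_row j (fst (rsk_fold B))"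
      have T: "tableau ?Q" "tableau (add_to_row k i ?Q)"
        using tableau_snd_rsk_fold[OF sorted] snoc.prems unfolding rsk_fold_snoc snd_conv k_def
        by (auto simp: sorted_append intro: tableau_snd_rsk_fold)
      have k: "k \<le> length ?Q" unfolding k_def length_rsk_fold by (rule new_cell_row_le)
      have s: "s = (if k < length ?Q then length (?Q ! k) else 0)"
        unfolding s_def k_def using new_cell_col_recording[of j B] by (simp add: Let_def)
      have "tail_word s ?Q = tail_word s (drop k ?Q) @ tail_word s (take k ?Q)"
        by (metis append_take_drop_id tail_word_append)
      also have "tail_word s (drop k ?Q) = []"
        using tableau_new_cell_rows(2)[OF T refl k s] by (rule tail_word_empty)
      finally have "\<forall>x\<in>set (tail_word s ?Q). x < i"
        using labels_above_new_cell[OF sorted] set_tail_word[of s "take k ?Q"] unfolding k_def by auto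
      then show ?thesis unfolding tail_depth_def 2 by (rule depth_zero)
    qed
    then have "d \<le> s" using d[of s] by (simp split: if_splits)
    then have "?f' r = (if r < Suc s then 1 else 0)" for r
      using f'[of r] d[of r] d[of s] 0 2 by (simp add: less_Suc_eq_le)
    then show ?thesis using 0 by (intro exI[of _ "Suc s"]) simp
  next
    case 3
    show ?thesis
    proof (cases "s < d")
      case True
      then have "?f' r = ?g' r + (if r < d then 1 else 0)" for r
        using f'[of r] g'[of r] d[of r] d[of s] 3 by simp
      then show ?thesis by blast
    next
      case False
      \<comment> \<open>Now \<open>?f s = ?g s\<close>, so both maxima are taken with the same
        value, and a difference survives only where \<open>r < d\<close> and
        \<open>?g s < ?g r\<close>. These \<open>r\<close> form an initial segment because
        \<open>?g\<close> is weakly decreasing.\<close>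
      define d' where "d' = (LEAST r. \<not> (r < d \<and> ?g s < ?g r))"
      have "r < d' \<longleftrightarrow> r < d \<and> ?g s < ?g r" for r
      proof
        show "r < d' \<Longrightarrow> r < d \<and> ?g s < ?g r" unfolding d'_def using not_less_Least by blast
        have "\<not> (d' < d \<and> ?g s < ?g d')" unfolding d'_def by (rule LeastI[of _ d]) simp
        moreover have "?g r \<le> ?g d'" if "d' \<le> r" using that by (rule tail_depth_antimono)
        ultimately show "r < d \<and> ?g s < ?g r \<Longrightarrow> r < d'" by (meson le_less_trans less_le_trans not_le)
      qed
      then have "?f' r = ?g' r + (if r < d' then 1 else 0)" for r
        using f'[of r] g'[of r] d[of r] d[of s] 3 False by auto
      then show ?thesis by blast
    qed
  qed
qed

subsection \<open>Keys\<close>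

lemma dec_above_0: "dec_above 0 u = decreasing_subwords u"
  by (simp add: dec_above_def)

lemma length_word_sup: "length (word_sup (decreasing_subwords u)) = depth 0 u"
  by (simp add: word_sup_def depth_def dec_above_0)

lemma nth_word_sup:
  "i < depth 0 u \<Longrightarrow> word_sup (decreasing_subwords u) ! i = Max {w ! i | w. w \<in> decreasing_subwords u \<and> i < length w}"
  by (simp add: word_sup_def depth_def dec_above_0)

lemma word_sup_candidates:
  assumes "i < depth 0 u"
  shows "finite {w ! i | w. w \<in> decreasing_subwords u \<and> i < length w}"
    "{w ! i | w. w \<in> decreasing_subwords u \<and> i < length w} \<noteq> {}"
proof -
  have "{w ! i | w. w \<in> decreasing_subwords u \<and> i < length w} \<subseteq> (\<lambda>w. w ! i) ` decreasing_subwords u" by auto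
  then show "finite {w ! i | w. w \<in> decreasing_subwords u \<and> i < length w}"
    using finite_decreasing_subwords finite_subset by blast
  obtain w where "w \<in> dec_above 0 u" "length w = depth 0 u" by (rule depth_obtain)
  then show "{w ! i | w. w \<in> decreasing_subwords u \<and> i < length w} \<noteq> {}"
    using assms by (auto simp: dec_above_0)
qed

text \<open>A decreasing subword whose letter at index \<open>i\<close> is at least \<open>x\<close>
  can be cut off after that letter; then all its letters are at least \<open>x\<close>. So depths
  determine the supremum.\<close>

lemma le_nth_word_sup:
  assumes "i < depth 0 u"
  shows "x \<le> word_sup (decreasing_subwords u) ! i \<longleftrightarrow> i < depth x u"
proof -
  have "x \<le> word_sup (decreasing_subwords u) ! i \<longleftrightarrow>
      (\<exists>w\<in>decreasing_subwords u. i < length w \<and> x \<le> w ! i)"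
    unfolding nth_word_sup[OF assms] Max_ge_iff[OF word_sup_candidates[OF assms]] by auto
  also have "\<dots> \<longleftrightarrow> i < depth x u"
  proof
    assume "\<exists>w\<in>decreasing_subwords u. i < length w \<and> x \<le> w ! i"
    then obtain w where w: "subseq w u" "sorted_wrt (>) w" "i < length w" "x \<le> w ! i"
      by (auto simp: decreasing_subwords_def)
    have "subseq (take (Suc i) w) u"
      using w(1) prefix_imp_subseq[OF take_is_prefix] subseq_order.order_trans by blast
    moreover have "\<forall>y\<in>set (take (Suc i) w). x \<le> y"
    proof
      fix y assume "y \<in> set (take (Suc i) w)"
      then obtain j where "j < Suc i" "y = w ! j" by (auto simp: in_set_conv_nth)
      then have "w ! i \<le> y" using sorted_wrt_nth_less[OF w(2), of j i] w(3) by (cases "j = i") auto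
      then show "x \<le> y" using w(4) by simp
    qed
    ultimately have "take (Suc i) w \<in> dec_above x u" using w(2) by (simp add: dec_above_iff sorted_wrt_take)
    then have "length (take (Suc i) w) \<le> depth x u" by (rule length_le_depth)
    then show "i < depth x u" using w(3) by simp
  next
    assume "i < depth x u"
    moreover obtain w where "w \<in> dec_above x u" "length w = depth x u" by (rule depth_obtain)
    ultimately show "\<exists>w\<in>decreasing_subwords u. i < length w \<and> x \<le> w ! i"
      by (auto simp: dec_above_def intro!: bexI[of _ w])
  qed
  finally show ?thesis .
qed

lemma set_word_sup: "set (word_sup (decreasing_subwords u)) \<subseteq> set u"
proof
  fix x assume "x \<in> set (word_sup (decreasing_subwords u))"
  then obtain i where i: "i < depth 0 u" "x = word_sup (decreasing_subwords u) ! i"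
    by (auto simp: in_set_conv_nth length_word_sup)
  then have "x \<in> {w ! i | w. w \<in> decreasing_subwords u \<and> i < length w}"
    using Max_in[OF word_sup_candidates[OF i(1)]] nth_word_sup[OF i(1)] by metis
  then obtain w where "w \<in> dec_above 0 u" "x \<in> set w" by (auto simp: dec_above_0)
  then show "x \<in> set u" using set_dec_above by blast
qed

lemma reading_word_columns_from: "reading_word (columns_from r T) = tail_word r T"
  by (induction T) (auto simp: columns_from_def)

definition key_col :: "nat \<Rightarrow> nat list list \<Rightarrow> nat list" where
  "key_col r T = rev (word_sup (decreasing_subwords (tail_word r T)))"

lemma right_key_eq: "right_key T = transpose (map (\<lambda>r. key_col r T) [0..<num_cols T])"
  by (simp add: right_key_def key_col_def reading_word_columns_from)

text \<open>Column \<open>r\<close>, read upwards, is such a subword; the clause on its letters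
  feeds the induction.\<close>

lemma column_dec_above:
  "tableau T \<Longrightarrow> \<exists>w\<in>dec_above 0 (tail_word r T). length w = col_height r T \<and>
     (\<forall>x\<in>set w. \<exists>S\<in>set T. r < length S \<and> S ! r \<le> x)"
proof (induction T)
  case Nil
  then show ?case by simp
next
  case (Cons R T)
  then obtain w where w: "w \<in> dec_above 0 (tail_word r T)" "length w = col_height r T"
     "\<forall>x\<in>set w. \<exists>S\<in>set T. r < length S \<and> S ! r \<le> x"
    by (auto simp: tableau_Cons)
  show ?case
  proof (cases "r < length R")
    case True
    have "\<forall>x\<in>set w. R ! r < x"
    proof
      fix x assume "x \<in> set w"
      then obtain S where "S \<in> set T" "r < length S" "S ! r \<le> x" using w(3) by blast
      then show "R ! r < x" using Cons.prems by (fastforce simp: tableau_def row_above_def)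
    qed
    moreover have "[R ! r] \<in> dec_above 0 (drop r R)"
      using True by (simp add: dec_above_iff subseq_singleton_left) (metis Cons_nth_drop_Suc list.set_intros(1))
    ultimately have "w @ [R ! r] \<in> dec_above 0 (tail_word r (R # T))"
      unfolding tail_word_Cons using w(1) by (intro dec_above_appendI) auto
    then show ?thesis using w True by (intro bexI[of _ "w @ [R ! r]"]) auto
  next
    case False
    then show ?thesis using w by (intro bexI[of _ w]) auto
  qed
qed

lemma tail_depth_0: assumes "tableau T" shows "tail_depth 0 r T = col_height r T"
proof (rule antisym)
  show "tail_depth 0 r T \<le> col_height r T" by (rule tail_depth_le_col_height[OF assms])
  show "col_height r T \<le> tail_depth 0 r T"
    using column_dec_above[OF assms, of r] length_le_depth unfolding tail_depth_def by metis
qed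

lemma length_key_col: "tableau T \<Longrightarrow> length (key_col r T) = col_height r T"
  using tail_depth_0[of T r] by (simp add: key_col_def length_word_sup tail_depth_def)

lemma le_nth_key_col:
  assumes "tableau T" "i < col_height r T"
  shows "x \<le> rev (key_col r T) ! i \<longleftrightarrow> i < tail_depth x r T"
  using le_nth_word_sup[of i "tail_word r T" x] assms tail_depth_0[OF assms(1), of r]
  by (simp add: key_col_def tail_depth_def)

lemma set_key_col: "set (key_col r T) \<subseteq> \<Union> (set ` set T)"
  using set_word_sup[of "tail_word r T"] by (auto simp: key_col_def tail_word_def reading_word_def dest: in_set_dropD)

lemma col_height_antimono: "r \<le> s \<Longrightarrow> col_height s T \<le> col_height r T"
  by (induction T) auto

lemma col_height_pos: "tableau T \<Longrightarrow> 0 < col_height r T \<longleftrightarrow> r < num_cols T"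
proof (induction T)
  case (Cons R T)
  have "\<forall>S\<in>set T. length S \<le> length R" using Cons.prems by (auto simp: tableau_def row_above_def)
  then have "r < length R" if "0 < col_height r T"
    using that by (auto simp: col_height_def filter_empty_conv intro: less_le_trans)
  then show ?case by (auto simp: num_cols_def)
qed (simp add: num_cols_def)

lemma num_cols_cong: "map length T = map length U \<Longrightarrow> num_cols T = num_cols U"
  by (cases T; cases U) (auto simp: num_cols_def)

section \<open>Comparing fillings column by column\<close>

lemma list_all2_transpose:
  assumes "list_all2 (list_all2 R) xs ys"
  shows "list_all2 (list_all2 R) (transpose xs) (transpose ys)"
proof -
  have len: "length (transpose xs) = length (transpose ys)"
    unfolding length_transpose using assms by (induction rule: list_all2_induct) (auto dest: list_all2_lengthD)
  have "list_all2 R (map (\<lambda>x. x ! i) (filter (\<lambda>x. i < length x) xs)) (map (\<lambda>x. x ! i) (filter (\<lambda>x. i < length x) ys))" for i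
    using assms
    by (induction rule: list_all2_induct) (auto dest: list_all2_lengthD list_all2_nthD2 list_all2_nthD)
  then show ?thesis using len by (simp add: list_all2_conv_all_nth[of "list_all2 R"] nth_transpose)
qed

text \<open>The condition under which \<open>transpose\<close> is undone by a second
  \<open>transpose\<close>.\<close>

definition column_list :: "nat list list \<Rightarrow> bool" where
  "column_list xs \<longleftrightarrow> sorted (rev (map length xs)) \<and> [] \<notin> set xs"

lemma transpose_column_list: "column_list xs \<Longrightarrow> transpose (transpose xs) = xs"
  unfolding column_list_def by (subst transpose_transpose) (auto simp: takeWhile_eq_all_conv)

lemma filling_le_transpose:
  assumes "column_list xs" "column_list ys"
  shows "filling_le (transpose xs) (transpose ys) \<longleftrightarrow> list_all2 (list_all2 (\<le>)) xs ys"
  unfolding filling_le_def using list_all2_transpose transpose_column_list assms by metis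

lemma sorted_rev_map_upt:
  assumes "\<And>r s. r \<le> s \<Longrightarrow> f s \<le> (f r :: nat)" shows "sorted (rev (map f [a..<b]))"
proof (induction b)
  case (Suc b)
  then show ?case using assms by auto
qed simp

lemma column_list_key_cols:
  assumes "tableau T" shows "column_list (map (\<lambda>r. key_col r T) [0..<num_cols T])"
proof -
  have "sorted (rev (map (\<lambda>r. col_height r T) [0..<num_cols T]))"
    by (intro sorted_rev_map_upt col_height_antimono)
  moreover have "key_col r T \<noteq> []" if "r < num_cols T" for r
    using that length_key_col[OF assms, of r] col_height_pos[OF assms, of r] by auto
  then have "[] \<notin> set (map (\<lambda>r. key_col r T) [0..<num_cols T])" by force
  ultimately show ?thesis using assms by (simp add: column_list_def comp_def length_key_col)
qed

lemma length_filter_mono: "(\<And>x. P x \<Longrightarrow> Q x) \<Longrightarrow> length (filter P xs) \<le> length (filter Q xs)"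
  by (induction xs) (auto intro: le_SucI)

lemma column_list_key_columns: "column_list (key_columns a)"
proof -
  have "sorted (rev (map (\<lambda>r. length (filter (\<lambda>i. r \<le> a ! (i - 1)) [1..<Suc (length a)])) [1..<Suc (Max (insert 0 (set a)))]))"
    by (intro sorted_rev_map_upt length_filter_mono) auto
  moreover have "filter (\<lambda>i. r \<le> a ! (i - 1)) [1..<Suc (length a)] \<noteq> []"
    if r: "1 \<le> r" "r \<le> Max (insert 0 (set a))" for r
  proof -
    have "Max (insert 0 (set a)) \<in> insert 0 (set a)" by (intro Max_in) auto
    then have "Max (insert 0 (set a)) \<in> set a" using r by auto
    then obtain i where "i < length a" "a ! i = Max (insert 0 (set a))" by (auto simp: in_set_conv_nth)
    then have "Suc i \<in> set (filter (\<lambda>i. r \<le> a ! (i - 1)) [1..<Suc (length a)])" using r by (auto simp del: upt_Suc)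
    then show ?thesis by (metis empty_iff empty_set)
  qed
  then have "[] \<notin> set (key_columns a)" unfolding key_columns_def by (force simp del: upt_Suc)
  ultimately show ?thesis unfolding column_list_def key_columns_def
    by (simp add: comp_def del: upt_Suc)
qed

lemma column_list_map:
  "column_list xs \<Longrightarrow> (\<And>x. length (f x) = length x) \<Longrightarrow> column_list (map f xs)"
  unfolding column_list_def by (auto simp: comp_def) (metis length_0_conv)

text \<open>Nested columns form a key: \<open>d y\<close> counts the columns that contain
  \<open>y\<close> and serves as the part of the composition with index \<open>y\<close>.\<close>

lemma key_columns_nested:
  assumes T: "tableau T" "\<forall>R\<in>set T. set R \<subseteq> {1..n}"
    and d: "\<And>y r. tail_depth y r T = tail_depth (Suc y) r T + (if r < d y then 1 else 0)"
  shows "key_columns (map d [1..<Suc n]) = map (\<lambda>r. key_col r T) [0..<num_cols T]"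
proof -
  have mem: "x \<in> set (key_col r T) \<longleftrightarrow> r < d x" for x r
  proof -
    have "x \<in> set (key_col r T) \<longleftrightarrow> (\<exists>i<col_height r T. rev (key_col r T) ! i = x)"
      using length_key_col[OF T(1)] by (metis in_set_conv_nth length_rev set_rev)
    \<comment> \<open>The letter \<open>x\<close> stands at an index where the threshold
      \<open>x\<close> is met but \<open>Suc x\<close> is not.\<close>
    also have "\<dots> \<longleftrightarrow> (\<exists>i<col_height r T. i < tail_depth x r T \<and> \<not> i < tail_depth (Suc x) r T)"
      using le_nth_key_col[OF T(1)] by (metis Suc_le_eq le_eq_less_or_eq nless_le)
    also have "\<dots> \<longleftrightarrow> r < d x"
    proof
      assume "r < d x"
      moreover have "tail_depth x r T \<le> col_height r T" using T(1) by (rule tail_depth_le_col_height)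
      ultimately show "\<exists>i<col_height r T. i < tail_depth x r T \<and> \<not> i < tail_depth (Suc x) r T"
        using d[of x r] by (intro exI[of _ "tail_depth (Suc x) r T"]) auto
    qed (use d[of x r] in \<open>auto split: if_splits\<close>)
    finally show ?thesis .
  qed
  have "sorted_wrt (>) (rev (key_col r T))" for r
    unfolding sorted_wrt_iff_nth_less
  proof (intro allI impI)
    fix i j assume ij: "i < j" "j < length (rev (key_col r T))"
    then have h: "j < col_height r T" "i < col_height r T" using length_key_col[OF T(1)] by auto
    have "j < tail_depth (rev (key_col r T) ! j) r T" using le_nth_key_col[OF T(1) h(1)] by blast
    then have "i < tail_depth (Suc (rev (key_col r T) ! j)) r T"
      using d[of "rev (key_col r T) ! j" r] ij(1) by (auto split: if_splits)
    then have "Suc (rev (key_col r T) ! j) \<le> rev (key_col r T) ! i"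
      using le_nth_key_col[OF T(1) h(2)] by blast
    then show "rev (key_col r T) ! j < rev (key_col r T) ! i" by (rule Suc_le_lessD)
  qed
  then have "sorted_wrt (<) (key_col r T)" for r by (simp add: sorted_wrt_rev)
  moreover have "set (key_col r T) \<subseteq> {1..n}" for r using set_key_col[of r T] T(2) by blast
  then have "set (key_col r T) = set (filter (\<lambda>i. r < d i) [1..<Suc n])" for r using mem by fastforce
  moreover have "sorted_wrt (<) (filter (\<lambda>i. r < d i) [1..<Suc n])" for r
    by (intro sorted_wrt_filter sorted_wrt_upt)
  ultimately have col: "key_col r T = filter (\<lambda>i. r < d i) [1..<Suc n]" for r
    by (intro strict_sorted_equal) auto
  have "Max (insert 0 (set (map d [1..<Suc n]))) = num_cols T"
  proof (rule Max_eqI)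
    fix c assume "c \<in> insert 0 (set (map d [1..<Suc n]))"
    then consider "c = 0" | y where "c = d y" by auto
    then show "c \<le> num_cols T"
    proof cases
      case 2
      have "\<not> num_cols T < d y" using mem[of y "num_cols T"] length_key_col[OF T(1), of "num_cols T"]
          col_height_pos[OF T(1), of "num_cols T"] by auto
      then show ?thesis using 2 by simp
    qed simp
  next
    \<comment> \<open>A letter of the last column lies in all columns, so its part equals
      \<open>num_cols T\<close>.\<close>
    show "num_cols T \<in> insert 0 (set (map d [1..<Suc n]))"
    proof (cases "num_cols T")
      case (Suc c)
      then have "key_col c T \<noteq> []" using length_key_col[OF T(1), of c] col_height_pos[OF T(1), of c] by auto
      then obtain x where x: "x \<in> set (key_col c T)" by (meson last_in_set)
      then have "x \<in> {1..n}" using \<open>set (key_col c T) \<subseteq> {1..n}\<close> by blast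
      have "\<not> num_cols T < d x" using mem[of x "num_cols T"] length_key_col[OF T(1), of "num_cols T"]
          col_height_pos[OF T(1), of "num_cols T"] by auto
      moreover have "c < d x" using x mem by blast
      ultimately have "d x = num_cols T" using Suc by simp
      moreover have "d x \<in> set (map d [1..<Suc n])" using \<open>x \<in> {1..n}\<close> by (auto simp del: upt_Suc)
      ultimately show ?thesis by simp
    qed simp
  qed simp
  moreover have "filter (\<lambda>i. Suc r \<le> map d [1..<Suc n] ! (i - 1)) [1..<Suc n] = key_col r T" for r
    unfolding col by (intro filter_cong) (auto simp: Suc_le_eq simp del: upt_Suc)
  ultimately show ?thesis
    unfolding key_columns_def
    by (intro nth_equalityI) (auto simp del: upt_Suc)
qed

text \<open>
  \<open>F\<close> and \<open>G\<close> count the letters of a column \<open>p\<close> and \<open>q\<close> that are at least the argument; an entry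
  violating the inequality corresponds to a pair of thresholds with \<open>F + G > h\<close>.
\<close>

lemma column_le_iff:
  fixes p q :: "nat list" and F G k :: "nat \<Rightarrow> nat"
  assumes "length p = h" "length q = h"
    and p: "\<And>i x. i < h \<Longrightarrow> x \<le> rev p ! i \<longleftrightarrow> i < F x"
    and q: "\<And>i x. i < h \<Longrightarrow> x \<le> rev q ! i \<longleftrightarrow> i < G x"
    and le: "\<And>x. F x \<le> h" "\<And>x. G x \<le> h" and qn: "set q \<subseteq> {1..n}"
    and k: "\<And>i j. 1 \<le> i \<Longrightarrow> i \<le> j \<Longrightarrow> j \<le> n \<Longrightarrow> k j \<le> k i"
  shows "list_all2 (\<le>) p (rev (map k q)) \<longleftrightarrow> (\<forall>a\<in>{1..n}. F (Suc (k a)) + G a \<le> h)"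
proof -
  \<comment> \<open>The reversal in \<open>B_plus\<close> pairs index \<open>i\<close> of
    \<open>rev q\<close> with index \<open>h - Suc i\<close> of \<open>rev p\<close>.\<close>
  have "list_all2 (\<le>) p (rev (map k q)) \<longleftrightarrow> (\<forall>i<h. rev p ! (h - Suc i) \<le> k (rev q ! i))"
    unfolding list_all2_conv_all_nth rev_map using assms(1,2) by (auto simp: rev_nth)
  also have "\<dots> \<longleftrightarrow> (\<forall>a\<in>{1..n}. F (Suc (k a)) + G a \<le> h)"
  proof
    assume A: "\<forall>i<h. rev p ! (h - Suc i) \<le> k (rev q ! i)"
    show "\<forall>a\<in>{1..n}. F (Suc (k a)) + G a \<le> h"
    proof (intro ballI leI notI)
      fix a assume a: "a \<in> {1..n}" and gt: "h < F (Suc (k a)) + G a"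
      \<comment> \<open>The last index with \<open>a \<le> rev q ! i\<close>; \<open>G a\<close> is
        positive since \<open>F (Suc (k a)) \<le> h\<close>.\<close>
      define i where "i = G a - 1"
      have i: "i < h" "i < G a" "h - Suc i < F (Suc (k a))"
        using gt le(1)[of "Suc (k a)"] le(2)[of a] by (auto simp: i_def)
      have "a \<le> rev q ! i" using q i by blast
      moreover have "rev q ! i \<in> {1..n}" using qn i(1) assms(2) by (metis length_rev nth_mem set_rev subsetD)
      ultimately have "k (rev q ! i) \<le> k a" using a k by simp
      moreover have "Suc (k a) \<le> rev p ! (h - Suc i)" using p i by simp
      ultimately show False using A i(1) by fastforce
    qed
  next
    assume A: "\<forall>a\<in>{1..n}. F (Suc (k a)) + G a \<le> h"
    show "\<forall>i<h. rev p ! (h - Suc i) \<le> k (rev q ! i)"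
    proof (intro allI impI leI notI)
      fix i assume i: "i < h" and gt: "k (rev q ! i) < rev p ! (h - Suc i)"
      \<comment> \<open>The entry of \<open>q\<close> at the violation is itself the
        threshold.\<close>
      define a where "a = rev q ! i"
      have "a \<in> {1..n}" unfolding a_def using qn i assms(2) by (metis length_rev nth_mem set_rev subsetD)
      moreover have "i < G a" using q[OF i, of a] unfolding a_def by blast
      moreover have "h - Suc i < F (Suc (k a))" using p[of "h - Suc i" "Suc (k a)"] i gt by (simp add: a_def)
      ultimately show False using A i by fastforce
    qed
  qed
  finally show ?thesis .
qed

lemma admissible_iff:
  assumes P: "P \<in> Tab m" and Q: "Q \<in> Tab n" and sh: "shape P = shape Q"
    and nested: "\<And>y. \<exists>d. \<forall>r. tail_depth y r Q = tail_depth (Suc y) r Q + (if r < d then 1 else 0)"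
    and kappa: "length kappa = n" "sorted_wrt (\<ge>) kappa"
  shows "admissible n m kappa (P, Q) \<longleftrightarrow>
    (\<forall>a\<in>{1..n}. \<forall>r. tail_depth (Suc (kappa ! (a - 1))) r P + tail_depth a r Q \<le> col_height r P)"
proof -
  let ?k = "\<lambda>p. kappa ! (p - 1)"
  let ?B = "\<lambda>col. rev (map ?k col)"
  have T: "tableau P" "tableau Q" "\<forall>R\<in>set Q. set R \<subseteq> {1..n}" using P Q by (auto simp: Tab_iff)
  obtain d where d: "\<And>y r. tail_depth y r Q = tail_depth (Suc y) r Q + (if r < d y then 1 else 0)"
    using nested by metis
  have c: "num_cols P = num_cols Q" "col_height r P = col_height r Q" for r
    using sh unfolding shape_def by (auto intro: num_cols_cong col_height_cong)
  define a where "a = map d [1..<Suc n]"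
  have a: "length a = n" "key_columns a = map (\<lambda>r. key_col r Q) [0..<num_cols Q]"
    unfolding a_def using key_columns_nested[OF T(2,3) d] by simp_all
  \<comment> \<open>A composition with the same key has the same columns, and \<open>B_plus\<close>
    depends on it only through \<open>key_columns\<close>. Hence any witness of admissibility can be
    replaced by \<open>a\<close>.\<close>
  have unique: "key_columns a' = key_columns a" if "right_key Q = key a'" for a'
    using that transpose_column_list[OF column_list_key_columns] transpose_column_list[OF column_list_key_cols[OF T(2)]]
    unfolding right_key_eq key_def a(2) by metis
  have "admissible n m kappa (P, Q) \<longleftrightarrow> filling_le (right_key P) (B_plus kappa a)"
  proof
    assume "admissible n m kappa (P, Q)"
    then show "filling_le (right_key P) (B_plus kappa a)"
      unfolding admissible_def B_plus_def using unique by auto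
  next
    have "right_key Q = key a" by (simp add: right_key_eq key_def a)
    then show "filling_le (right_key P) (B_plus kappa a) \<Longrightarrow> admissible n m kappa (P, Q)"
      unfolding admissible_def using P Q sh a(1) by auto
  qed
  also have "\<dots> \<longleftrightarrow> list_all2 (list_all2 (\<le>)) (map (\<lambda>r. key_col r P) [0..<num_cols P]) (map ?B (key_columns a))"
    unfolding right_key_eq B_plus_def
    by (intro filling_le_transpose column_list_key_cols T column_list_map column_list_key_columns) simp
  also have "\<dots> \<longleftrightarrow> (\<forall>r<num_cols P. list_all2 (\<le>) (key_col r P) (?B (key_col r Q)))"
    unfolding a(2) by (simp add: list_all2_conv_all_nth[of "list_all2 (\<le>)"] c(1))
  also have "\<dots> \<longleftrightarrow> (\<forall>r<num_cols P. \<forall>a\<in>{1..n}. tail_depth (Suc (?k a)) r P + tail_depth a r Q \<le> col_height r P)"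
  proof -
    have "list_all2 (\<le>) (key_col r P) (?B (key_col r Q)) \<longleftrightarrow>
       (\<forall>a\<in>{1..n}. tail_depth (Suc (?k a)) r P + tail_depth a r Q \<le> col_height r P)" for r
    proof (rule column_le_iff[where F = "\<lambda>x. tail_depth x r P" and G = "\<lambda>x. tail_depth x r Q"])
      show "set (key_col r Q) \<subseteq> {1..n}" using set_key_col[of r Q] T(3) by blast
      show "kappa ! (j - 1) \<le> kappa ! (i - 1)" if "1 \<le> i" "i \<le> j" "j \<le> n" for i j
        using that kappa by (cases "i = j") (auto simp: sorted_wrt_iff_nth_less)
    qed (use T in \<open>simp_all add: length_key_col le_nth_key_col tail_depth_le_col_height c(2)
        tail_depth_le_col_height[of P, unfolded c(2)]\<close>)
    then show ?thesis by blast
  qed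
  also have "\<dots> \<longleftrightarrow> (\<forall>a\<in>{1..n}. \<forall>r. tail_depth (Suc (?k a)) r P + tail_depth a r Q \<le> col_height r P)"
  proof -
    have "tail_depth b r P + tail_depth x r Q \<le> col_height r P" if "\<not> r < num_cols P" for b x r
    proof -
      have "col_height r P = 0" using that col_height_pos[OF T(1), of r] by auto
      then show ?thesis using tail_depth_le_col_height[OF T(1), of b r] tail_depth_le_col_height[OF T(2), of x r] c(2)[of r] by simp
    qed
    then show ?thesis by blast
  qed
  finally show ?thesis .
qed

text \<open>For each \<open>a\<close>, the block in rows from \<open>a\<close> on and columns beyond
  \<open>kappa ! (a - 1)\<close> has to vanish. Since \<open>kappa\<close> is weakly decreasing,
  these blocks together cover exactly the cells outside \<open>kappa\<close>.\<close>

lemma admissible_RSK_iff: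
  assumes "RSK n m A = (P, Q)" "length kappa = n" "sorted_wrt (\<ge>) kappa"
  shows "admissible n m kappa (P, Q) \<longleftrightarrow> (\<forall>(i, j)\<in>supp n m A. j \<le> kappa ! (i - 1))"
proof -
  have PQ: "P = fst (rsk_fold (biword n m A))" "Q = snd (rsk_fold (biword n m A))"
    using assms(1) by (simp_all add: RSK_eq)
  have "admissible n m kappa (P, Q) \<longleftrightarrow>
      (\<forall>a\<in>{1..n}. \<forall>r. tail_depth (Suc (kappa ! (a - 1))) r P + tail_depth a r Q \<le> col_height r P)"
    using RSK_Tab[OF assms(1)] assms(2,3) recording_tableau_nested[OF sorted_biword]
    unfolding PQ by (intro admissible_iff)
  also have "\<dots> \<longleftrightarrow> (\<forall>a\<in>{1..n}. \<forall>q\<in>supp n m A. \<not> (a \<le> fst q \<and> Suc (kappa ! (a - 1)) \<le> snd q))"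
    unfolding PQ block_zero_iff[OF sorted_biword] set_biword ..
  also have "\<dots> \<longleftrightarrow> (\<forall>(i, j)\<in>supp n m A. j \<le> kappa ! (i - 1))"
  proof
    assume A: "\<forall>a\<in>{1..n}. \<forall>q\<in>supp n m A. \<not> (a \<le> fst q \<and> Suc (kappa ! (a - 1)) \<le> snd q)"
    show "\<forall>(i, j)\<in>supp n m A. j \<le> kappa ! (i - 1)"
    proof clarify
      fix i j assume ij: "(i, j) \<in> supp n m A"
      then have "i \<in> {1..n}" by (simp add: supp_def)
      then show "j \<le> kappa ! (i - 1)" using A ij by fastforce
    qed
  next
    assume A: "\<forall>(i, j)\<in>supp n m A. j \<le> kappa ! (i - 1)"
    show "\<forall>a\<in>{1..n}. \<forall>q\<in>supp n m A. \<not> (a \<le> fst q \<and> Suc (kappa ! (a - 1)) \<le> snd q)"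
    proof (intro ballI notI)
      fix a q assume a: "a \<in> {1..n}" and q: "q \<in> supp n m A" "a \<le> fst q \<and> Suc (kappa ! (a - 1)) \<le> snd q"
      have "fst q \<le> n" using q(1) by (auto simp: supp_def)
      then have "kappa ! (fst q - 1) \<le> kappa ! (a - 1)"
        using a q(2) assms(2,3) by (cases "a = fst q") (auto simp: sorted_wrt_iff_nth_less)
      moreover have "snd q \<le> kappa ! (fst q - 1)" using A q(1) by fastforce
      ultimately show False using q(2) by simp
    qed
  qed
  finally show ?thesis .
qed

theorem proposition47:
  fixes n m :: nat
    and lam mu :: "nat list"
    and A :: "nat \<Rightarrow> nat \<Rightarrow> nat"
    and P Q :: "nat list list"
  assumes "partition_in_box n m lam"
    and "partition_in_box n m mu"
    and "partition_subset mu lam"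
    and "RSK n m A = (P, Q)"
  shows "supp n m A \<subseteq> skew_diagram n lam mu \<longleftrightarrow>
    admissible n m lam (P, Q) \<and>
    admissible n m (box_complement m mu) (ev m P, ev n Q)"
proof -
  have lam: "length lam = n" "sorted_wrt (\<ge>) lam" using assms(1) by (simp_all add: partition_in_box_def)
  have mu: "length mu = n" "sorted_wrt (\<ge>) mu" "\<forall>x\<in>set mu. x \<le> m"
    using assms(2) by (simp_all add: partition_in_box_def)
  have bc: "length (box_complement m mu) = n" by (simp add: box_complement_def mu)
  have bc_nth: "box_complement m mu ! i = m - mu ! (n - Suc i)" if "i < n" for i
    using that mu(1) by (simp add: box_complement_def rev_nth)
  have bc_sorted: "sorted_wrt (\<ge>) (box_complement m mu)"
    unfolding sorted_wrt_iff_nth_less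
  proof (intro allI impI)
    fix i j assume ij: "i < j" "j < length (box_complement m mu)"
    then have "mu ! (n - Suc i) \<le> mu ! (n - Suc j)"
      using mu(1,2) bc sorted_wrt_nth_less[OF mu(2), of "n - Suc j" "n - Suc i"] by auto
    then show "box_complement m mu ! j \<le> box_complement m mu ! i" using ij bc by (simp add: bc_nth)
  qed
  \<comment> \<open>The criterion is applied to the rotated matrix, whose RSK image is the evacuated
    pair.\<close>
  have "admissible n m (box_complement m mu) (ev m P, ev n Q) \<longleftrightarrow>
      (\<forall>(i, j)\<in>supp n m (rotate_matrix n m A). j \<le> box_complement m mu ! (i - 1))"
    by (rule admissible_RSK_iff[OF RSK_rotate[OF assms(4)] bc bc_sorted])
  also have "\<dots> \<longleftrightarrow> (\<forall>(i, j)\<in>supp n m A. mu ! (i - 1) < j)"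
  proof -
    have in_rotate: "(n + 1 - i, m + 1 - j) \<in> supp n m (rotate_matrix n m A)" if "(i, j) \<in> supp n m A" for i j
      using that by (auto simp: rotate_matrix_def supp_def)
    \<comment> \<open>Rotation turns the upper bound by the complement into a strict lower bound by
      \<open>mu\<close>; parts of \<open>mu\<close> are at most \<open>m\<close>, so the subtraction
      is exact.\<close>
    have iff: "m + 1 - j \<le> box_complement m mu ! (n + 1 - i - 1) \<longleftrightarrow> mu ! (i - 1) < j"
      if "i \<in> {1..n}" "j \<in> {1..m}" for i j
    proof -
      have "i - 1 < length mu" using that mu(1) by auto
      then have "mu ! (i - 1) \<le> m" using mu(3) nth_mem by blast
      moreover have "box_complement m mu ! (n + 1 - i - 1) = m - mu ! (i - 1)"
        using that bc_nth[of "n - i"] by simp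
      ultimately show ?thesis using that by auto
    qed
    show ?thesis
    proof
      assume A: "\<forall>(i, j)\<in>supp n m (rotate_matrix n m A). j \<le> box_complement m mu ! (i - 1)"
      show "\<forall>(i, j)\<in>supp n m A. mu ! (i - 1) < j"
      proof clarify
        fix i j assume ij: "(i, j) \<in> supp n m A"
        then have "m + 1 - j \<le> box_complement m mu ! (n + 1 - i - 1)" using A in_rotate by blast
        then show "mu ! (i - 1) < j" using iff[of i j] ij by (auto simp: supp_def)
      qed
    next
      assume A: "\<forall>(i, j)\<in>supp n m A. mu ! (i - 1) < j"
      show "\<forall>(i, j)\<in>supp n m (rotate_matrix n m A). j \<le> box_complement m mu ! (i - 1)"
      proof clarify
        fix i j assume "(i, j) \<in> supp n m (rotate_matrix n m A)"
        then have ij: "i \<in> {1..n}" "j \<in> {1..m}" "(n + 1 - i, m + 1 - j) \<in> supp n m A"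
          by (auto simp: supp_rotate)
        then have "mu ! (n + 1 - i - 1) < m + 1 - j" using A by blast
        moreover have ij2: "n + 1 - (n + 1 - i) = i" "m + 1 - (m + 1 - j) = j" using ij by auto
        moreover have "n + 1 - i \<in> {1..n}" "m + 1 - j \<in> {1..m}" using ij by auto
        ultimately show "j \<le> box_complement m mu ! (i - 1)"
          using iff[of "n + 1 - i" "m + 1 - j"] unfolding ij2 by blast
      qed
    qed
  qed
  finally have "admissible n m (box_complement m mu) (ev m P, ev n Q) \<longleftrightarrow>
      (\<forall>(i, j)\<in>supp n m A. mu ! (i - 1) < j)" .
  moreover have "admissible n m lam (P, Q) \<longleftrightarrow> (\<forall>(i, j)\<in>supp n m A. j \<le> lam ! (i - 1))"
    by (rule admissible_RSK_iff[OF assms(4) lam])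
  moreover have "supp n m A \<subseteq> skew_diagram n lam mu \<longleftrightarrow>
      (\<forall>(i, j)\<in>supp n m A. mu ! (i - 1) < j \<and> j \<le> lam ! (i - 1))"
    by (auto simp: skew_diagram_def supp_def)
  ultimately show ?thesis by auto
qed

end
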